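(* Let $(G,K)$ be a compact Gelfand pair, let $L$ be a locally compact group with neutral element $e_L$, and let $f:G\times L\to\mathbb{C}$ be a continuous function. Then $f$ belongs to $\mathcal P_K^\sharp(G,L)$ if and only if there exists a function $B:Z\to\mathcal P(L)$ (i.e. a family $(B(\varphi))_{\varphi\in Z}$ of continuous positive definite functions on $L$) satisfying $\sum_{\varphi\in Z}B(\varphi)(e_L)<\infty$ such that $$f(x,u)=\sum_{\varphi\in Z}B(\varphi)(u)\varphi(x),\qquad x\in G,\ u\in L.$$ This expansion is uniformly convergent for $(x,u)\in G\times L$, and $$B(\varphi)(u)=\delta(\varphi)\int_G f(x,u)\overline{\varphi(x)}\,d\omega_G(x),\qquad u\in L.$$
   Context: For a locally compact group $H$, a continuous function $g:H\to\mathbb{C}$ is positive definite if for all $n\in\mathbb{N}$, $x_1,\dots,x_n\in H$, $c_1,\dots,c_n\in\mathbb{C}$ one has $\sum_{j,k}g(x_j^{-1}x_k)c_j\overline{c_k}\ge0$; the set of such functions is $\mathcal P(H)$. Let $G$ be a locally compact group and $K$ a compact subgroup; a function $g$ on $G$ is bi-invariant with respect to $K$ if $g(kxl)=g(x)$ for all $x\in G$, $k,l\in K$. $(G,K)$ is a Gelfand pair if the algebra of continuous compactly supported bi-$K$-invariant functions on $G$ is commutative under convolution $f*g(x)=\int_G f(y)g(y^{-1}x)\,d\omega_G(y)$; it is a compact Gelfand pair if moreover $G$ is compact. $\omega_G$ denotes Haar measure on $G$ normalized to $\omega_G(G)=1$, and $\omega_K$ normalized Haar measure on $K$. A spherical function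 for $(G,K)$ is a continuous $\varphi:G\to\mathbb{C}$ with $\int_K\varphi(xky)\,d\omega_K(k)=\varphi(x)\varphi(y)$ for all $x,y\in G$ and $\varphi(e_G)=1$. $Z$ denotes the set of positive definite spherical functions. For $\varphi\in Z$, $\delta(\varphi)$ is the (finite) dimension of the linear span of the functions $x\mapsto\varphi(g^{-1}x)$, $g\in G$. $\mathcal P_K^\sharp(G,L)$ denotes the set of continuous positive definite functions $f$ on the product group $G\times L$ which are bi-invariant with respect to $K$ in the first variable, i.e. $f(kxl,u)=f(x,u)$ for $k,l\in K$, $x\in G$, $u\in L$. *)

theory Defs
  imports "HOL-Analysis.Analysis" "HOL-Library.Complex_Order" "HOL-Library.Function_Algebras"
begin

text \<open>Groups are types of class topological_group_add (group operation written +,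
 neutral element 0, inverse uminus; commutativity is NOT assumed).\<close>

definition haar_prob :: "'g::topological_group_add measure \<Rightarrow> 'g set \<Rightarrow> bool" where
  "haar_prob M H \<longleftrightarrow> space M = H \<and> emeasure M H = 1 \<and> sets M = sets (restrict_space borel H) \<and>
     (\<forall>g\<in>H. \<forall>A\<in>sets M. emeasure M ((\<lambda>y. g + y) ` A) = emeasure M A)"

definition compact_subgroup :: "'g::topological_group_add set \<Rightarrow> bool" where
  "compact_subgroup K \<longleftrightarrow> compact K \<and> 0 \<in> K \<and> (\<forall>x\<in>K. \<forall>y\<in>K. x + y \<in> K) \<and> (\<forall>x\<in>K. - x \<in> K)"

definition pos_def :: "('h::topological_group_add \<Rightarrow> complex) \<Rightarrow> bool" where
  "pos_def g \<longleftrightarrow> continuous_on UNIV g \<and>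
     (\<forall>(n::nat) (x::nat \<Rightarrow> 'h) (c::nat \<Rightarrow> complex).
        (\<Sum>j<n. \<Sum>k<n. g (- x j + x k) * c j * cnj (c k)) \<ge> 0)"

definition bi_invariant :: "'g::topological_group_add set \<Rightarrow> ('g \<Rightarrow> 'b) \<Rightarrow> bool" where
  "bi_invariant K g \<longleftrightarrow> (\<forall>k\<in>K. \<forall>l\<in>K. \<forall>x. g (k + x + l) = g x)"

definition convolution :: "'g::topological_group_add measure \<Rightarrow> ('g \<Rightarrow> complex) \<Rightarrow> ('g \<Rightarrow> complex) \<Rightarrow> 'g \<Rightarrow> complex" where
  "convolution \<omega> f g x = integral\<^sup>L \<omega> (\<lambda>y. f y * g (- y + x))"

definition gelfand_pair :: "'g::topological_group_add measure \<Rightarrow> 'g set \<Rightarrow> bool" where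
  "gelfand_pair \<omega>G K \<longleftrightarrow> compact_subgroup K \<and>
     (\<forall>f g. continuous_on UNIV f \<and> compact (closure {x. f x \<noteq> 0}) \<and> bi_invariant K f \<and>
            continuous_on UNIV g \<and> compact (closure {x. g x \<noteq> 0}) \<and> bi_invariant K g \<longrightarrow>
            convolution \<omega>G f g = convolution \<omega>G g f)"

definition spherical :: "'g::topological_group_add measure \<Rightarrow> ('g \<Rightarrow> complex) \<Rightarrow> bool" where
  "spherical \<omega>K \<phi> \<longleftrightarrow> continuous_on UNIV \<phi> \<and> \<phi> 0 = 1 \<and>
     (\<forall>x y. integral\<^sup>L \<omega>K (\<lambda>k. \<phi> (x + k + y)) = \<phi> x * \<phi> y)"

definition Zsph :: "'g::topological_group_add measure \<Rightarrow> ('g \<Rightarrow> complex) set" where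
  "Zsph \<omega>K = {\<phi>. spherical \<omega>K \<phi> \<and> pos_def \<phi>}"

definition delta :: "('g::topological_group_add \<Rightarrow> complex) \<Rightarrow> nat" where
  "delta \<phi> = vector_space.dim (\<lambda>(c::complex) (h::'g \<Rightarrow> complex). (\<lambda>x. c * h x))
              (range (\<lambda>g. (\<lambda>x. \<phi> (- g + x))))"

definition P_sharp :: "'g::topological_group_add set \<Rightarrow> ('g \<times> 'l::topological_group_add \<Rightarrow> complex) \<Rightarrow> bool" where
  "P_sharp K f \<longleftrightarrow> continuous_on UNIV f \<and>
     (\<forall>(n::nat) (x::nat \<Rightarrow> 'g) (u::nat \<Rightarrow> 'l) (c::nat \<Rightarrow> complex).
        (\<Sum>j<n. \<Sum>k<n. f (- x j + x k, - u j + u k) * c j * cnj (c k)) \<ge> 0) \<and>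
     (\<forall>k\<in>K. \<forall>l\<in>K. \<forall>x u. f (k + x + l, u) = f (x, u))"

end

theory Submission
  imports Defs
begin

text \<open>Positive definite spherical functions satisfy \<open>F * \<phi> = \<langle>F, \<phi>\<rangle> \<phi>\<close> for every bi-invariant \<open>F\<close>.
  Hence they are pairwise orthogonal, the kernel \<open>\<phi> (- y + x) / \<parallel>\<phi>\<parallel>\<^sup>2\<close> reproduces the span of the
  translates of \<open>\<phi>\<close>, and taking its trace gives \<open>\<delta>(\<phi>) \<parallel>\<phi>\<parallel>\<^sup>2 = 1\<close>.  They are complete: if a bi-invariant
  \<open>R \<noteq> 0\<close> were orthogonal to all of them, power iteration on the hermitian element \<open>R * star R\<close> of the
  commutative convolution algebra would produce a nonzero idempotent, and below it a minimal one,
  which is a multiple of a spherical function not orthogonal to \<open>R\<close>.  For \<open>f\<close> in the class of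
  the theorem, the coefficients are positive definite in \<open>u\<close> and their values at the neutral element
  are summable by Bessel's inequality, so the series converges uniformly, and by completeness its sum
  is \<open>f\<close>.  The Haar measure need not be regular here, and the groups need not be second countable;
  Fubini's theorem is therefore only used for continuous integrands, where Riemann sums prove it.\<close>

section \<open>Integration of continuous functions over compact spaces\<close>

text \<open>No Hilbert space is completed and no spectral theorem for compact operators is invoked:
  every object stays a continuous function. What pays for this is the pointwise estimate
  \<open>norm_convolution_le\<close>, which bounds a convolution uniformly by the mean-square norms
  of its factors. It allows limits to be uniform; and its consequence
  \<open>sq_convolution_le\<close>, read for \<open>q = q * q\<close>, forces every nonzero
  idempotent to have squared norm at least 1. Hence passing to a proper sub-idempotent lowers the
  squared norm by at least 1, and a minimal idempotent exists before anything is known about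
  dimensions. Commutativity enters through this order on idempotents and through \<open>star\<close>
  becoming multiplicative, which keeps products of hermitian elements hermitian. As \<open>Z\<close>
  may be uncountable, the series are unconditional sums over finite subsets; a summable majorant
  built from the values at the neutral element of \<open>L\<close> makes one finite set serve all
  \<open>(x, u)\<close>.\<close>

locale compact_borel_prob =
  fixes M :: "'a::topological_space measure"
  assumes compact_space: "compact (UNIV :: 'a set)"
    and sets_borel: "sets M = sets borel"
    and total_mass: "emeasure M UNIV = 1"
begin

lemma space_UNIV: "space M = UNIV"
  using sets_eq_imp_space_eq[OF sets_borel] by simp

sublocale finite_measure M
  by standard (simp add: space_UNIV total_mass)

lemma measure_UNIV: "measure M UNIV = 1"
  by (simp add: measure_def total_mass)

lemma borel_measurable_continuous:
  "continuous_on UNIV h \<Longrightarrow> h \<in> borel_measurable M"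
  using borel_measurable_continuous_onI measurable_cong_sets[OF sets_borel refl] by blast

lemma integrable_continuous:
  fixes h :: "'a \<Rightarrow> 'b::{banach, second_countable_topology}"
  assumes "continuous_on UNIV h"
  shows "integrable M h"
proof -
  have "bounded (range h)"
    by (intro compact_imp_bounded compact_continuous_image assms compact_space)
  then obtain b where "\<And>x. norm (h x) \<le> b"
    by (auto simp: bounded_iff)
  then show ?thesis
    by (intro integrable_const_bound[where B = b] borel_measurable_continuous assms) auto
qed

lemma integral_const: "integral\<^sup>L M (\<lambda>x. c :: 'b::{banach, second_countable_topology}) = c"
  by (simp add: space_UNIV measure_UNIV)

lemma norm_integral_le:
  fixes h :: "'a \<Rightarrow> 'b::{banach, second_countable_topology}"
  assumes "integrable M h" and "\<And>x. norm (h x) \<le> e"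
  shows "norm (integral\<^sup>L M h) \<le> e"
proof -
  have "norm (integral\<^sup>L M h) \<le> (\<integral>x. norm (h x) \<partial>M)"
    by (rule integral_norm_bound)
  also have "\<dots> \<le> (\<integral>x. e \<partial>M)"
    using assms by (intro integral_mono) auto
  finally show ?thesis by (simp only: integral_const)
qed

end

section \<open>Continuity of integrals in a parameter\<close>

lemma continuous_slice:
  assumes "continuous_on UNIV (\<lambda>(x, y). H x y)"
  shows "continuous_on UNIV (H x)" and "continuous_on UNIV (\<lambda>x. H x y)"
  using continuous_on_compose2[OF assms, of UNIV "\<lambda>y. (x, y)"]
    continuous_on_compose2[OF assms, of UNIV "\<lambda>x. (x, y)"]
  by (simp_all add: continuous_on_Pair)

lemma continuous_swap:
  assumes "continuous_on UNIV (\<lambda>(x, y). H x y)"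
  shows "continuous_on UNIV (\<lambda>(y, x). H x y)"
  using continuous_on_compose2[OF assms continuous_on_swap, of UNIV]
  by (simp add: split_beta prod.swap_def)

lemma uniform_neighbourhood:
  fixes H :: "'a::topological_space \<Rightarrow> 'b::topological_space \<Rightarrow> 'c::metric_space"
  assumes "continuous_on UNIV (\<lambda>(x, y). H x y)" and "compact (UNIV :: 'b set)" and "e > 0"
  obtains U where "open U" and "x0 \<in> U" and "\<And>x y. x \<in> U \<Longrightarrow> dist (H x y) (H x0 y) \<le> e"
  using continuous_on_prod_compactE[of UNIV UNIV "\<lambda>(x, y). H x y" x0 e] assms
  by (metis IntI UNIV_I UNIV_Times_UNIV case_prod_conv)

lemma (in compact_borel_prob) continuous_on_integral:
  fixes H :: "'b::topological_space \<Rightarrow> 'a \<Rightarrow> complex"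
  assumes "continuous_on UNIV (\<lambda>(y, x). H y x)"
  shows "continuous_on UNIV (\<lambda>y. integral\<^sup>L M (H y))"
proof -
  have "((\<lambda>y. integral\<^sup>L M (H y)) \<longlongrightarrow> integral\<^sup>L M (H y0)) (at y0)" for y0
  proof (rule tendstoI)
    fix e :: real assume "e > 0"
    then obtain U where U: "open U" "y0 \<in> U" "\<And>y x. y \<in> U \<Longrightarrow> dist (H y x) (H y0 x) \<le> e / 2"
      using uniform_neighbourhood[OF assms compact_space, of "e / 2"] by (metis half_gt_zero)
    have "dist (integral\<^sup>L M (H y)) (integral\<^sup>L M (H y0)) < e" if "y \<in> U" for y
    proof -
      have i: "integrable M (H y)" for y
        by (intro integrable_continuous continuous_slice[OF assms])
      have "dist (integral\<^sup>L M (H y)) (integral\<^sup>L M (H y0)) = norm (\<integral>x. H y x - H y0 x \<partial>M)"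
        by (simp add: dist_norm i)
      also have "\<dots> \<le> e / 2"
        using U(3)[OF that] by (intro norm_integral_le Bochner_Integration.integrable_diff i) (auto simp: dist_norm)
      finally show ?thesis using \<open>e > 0\<close> by simp
    qed
    then show "\<forall>\<^sub>F y in at y0. dist (integral\<^sup>L M (H y)) (integral\<^sup>L M (H y0)) < e"
      using U(1,2) unfolding eventually_at_topological by blast
  qed
  then show ?thesis
    by (simp add: continuous_on_def)
qed

section \<open>Riemann sums and the exchange of integrals\<close>

text \<open>Neighbourhoods that control \<open>H\<close> uniformly in \<open>y\<close> cover the
  compact space; a finite subcover is made disjoint to obtain Borel cells. The sample point
  \<open>p i\<close> is the centre of the i-th neighbourhood and may lie outside the cell
  \<open>A i\<close>, which can even be empty.\<close>

lemma uniform_partition: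
  fixes H :: "'a::topological_space \<Rightarrow> 'b::topological_space \<Rightarrow> 'c::metric_space"
  assumes "continuous_on UNIV (\<lambda>(x, y). H x y)" and "compact (UNIV :: 'a set)"
    and "compact (UNIV :: 'b set)" and "e > 0"
  obtains n :: nat and p :: "nat \<Rightarrow> 'a" and A :: "nat \<Rightarrow> 'a set"
  where "\<And>i. A i \<in> sets borel" and "disjoint_family A" and "(\<Union>i<n. A i) = UNIV"
    and "\<And>i x y. i < n \<Longrightarrow> x \<in> A i \<Longrightarrow> dist (H x y) (H (p i) y) \<le> e"
proof -
  have "\<forall>x0. \<exists>U. open U \<and> x0 \<in> U \<and> (\<forall>x\<in>U. \<forall>y. dist (H x y) (H x0 y) \<le> e)"
  proof
    fix x0
    obtain U where "open U" "x0 \<in> U" "\<And>x y. x \<in> U \<Longrightarrow> dist (H x y) (H x0 y) \<le> e"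
      by (rule uniform_neighbourhood[OF assms(1,3,4), of x0]) (rule that)
    then show "\<exists>U. open U \<and> x0 \<in> U \<and> (\<forall>x\<in>U. \<forall>y. dist (H x y) (H x0 y) \<le> e)"
      by blast
  qed
  from choice[OF this] obtain U where U: "\<And>x0. open (U x0)" "\<And>x0. x0 \<in> U x0"
      "\<And>x0 x y. x \<in> U x0 \<Longrightarrow> dist (H x y) (H x0 y) \<le> e"
    by blast
  have "UNIV \<subseteq> (\<Union>x\<in>UNIV. U x)"
    using U(2) by blast
  then obtain C where C: "finite C" "UNIV \<subseteq> (\<Union>x\<in>C. U x)"
    by (rule compactE_image[OF assms(2) U(1)]) (rule that)
  obtain p where p: "bij_betw p {..<card C} C"
    using ex_bij_betw_nat_finite[OF C(1)] unfolding lessThan_atLeast0 by blast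
  have "(\<Union>i<card C. U (p i)) = (\<Union>x\<in>p ` {..<card C}. U x)"
    by simp
  then have UN: "(\<Union>i<card C. U (p i)) = UNIV"
    unfolding bij_betw_imp_surj_on[OF p] using C(2) by (simp add: top.extremum_unique)
  show ?thesis
  proof (rule that[of "disjointed (\<lambda>i. U (p i))" "card C" p])
    show "disjointed (\<lambda>i. U (p i)) i \<in> sets borel" for i
      using U(1) unfolding disjointed_def by (intro sets.Diff sets.finite_UN) auto
    show "disjoint_family (disjointed (\<lambda>i. U (p i)))"
      by (rule disjoint_family_disjointed)
    show "(\<Union>i<card C. disjointed (\<lambda>i. U (p i)) i) = UNIV"
      using finite_UN_disjointed_eq[of "\<lambda>i. U (p i)" "card C"] UN
      by (simp add: lessThan_atLeast0)
    show "dist (H x y) (H (p i) y) \<le> e" if "x \<in> disjointed (\<lambda>i. U (p i)) i" for i x y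
      by (rule U(3)[OF subsetD[OF disjointed_subset that]])
  qed
qed

lemma (in compact_borel_prob) riemann_sum:
  fixes h :: "'a \<Rightarrow> complex" and n :: nat
  assumes "continuous_on UNIV h" and A: "\<And>i. A i \<in> sets borel" "disjoint_family A" "(\<Union>i<n. A i) = UNIV"
    and close: "\<And>i x. i < n \<Longrightarrow> x \<in> A i \<Longrightarrow> dist (h x) (h (p i)) \<le> e"
  shows "norm (integral\<^sup>L M h - (\<Sum>i<n. measure M (A i) * h (p i))) \<le> e"
proof -
  define s where "s x = (\<Sum>i<n. indicator (A i) x *\<^sub>R h (p i))" for x
  have s_int: "has_bochner_integral M s (\<Sum>i<n. measure M (A i) *\<^sub>R h (p i))"
    unfolding s_def
  proof (intro has_bochner_integral_sum)
    fix i
    show "has_bochner_integral M (\<lambda>x. indicator (A i) x *\<^sub>R h (p i)) (measure M (A i) *\<^sub>R h (p i))"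
      using A(1) by (intro has_bochner_integral_scaleR_left has_bochner_integral_real_indicator)
        (auto simp: sets_borel less_top[symmetric])
  qed
  have "norm (h x - s x) \<le> e" for x
  proof -
    obtain j where j: "j < n" "x \<in> A j"
      using A(3) by (metis UNIV_I UN_E lessThan_iff)
    have "x \<in> A i \<longleftrightarrow> i = j" for i
      using A(2) j unfolding disjoint_family_on_def by blast
    then have "s x = (\<Sum>i<n. if i = j then h (p i) else 0)"
      unfolding s_def by (intro sum.cong) (auto simp: indicator_def)
    then have "s x = h (p j)"
      using j by simp
    then show ?thesis
      using close[OF j] by (simp add: dist_norm)
  qed
  moreover have h_int: "integrable M h"
    by (intro integrable_continuous assms)
  ultimately have "norm (\<integral>x. h x - s x \<partial>M) \<le> e"
    using s_int by (intro norm_integral_le) (auto simp: has_bochner_integral_iff)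
  then show ?thesis
    using s_int h_int by (simp add: has_bochner_integral_iff scaleR_conv_of_real)
qed

text \<open>The cells are fine uniformly in \<open>y\<close>, so one and the same finite sum,
  \<open>measure M (A i)\<close> times the integral of \<open>H (p i)\<close>, lies within
  \<open>e / 2\<close> of both iterated integrals. No measurability with respect to a product
  sigma-algebra is involved.\<close>

lemma integral_swap:
  fixes M :: "'a::topological_space measure" and N :: "'b::topological_space measure"
    and H :: "'a \<Rightarrow> 'b \<Rightarrow> complex"
  assumes "compact_borel_prob M" and "compact_borel_prob N"
    and H: "continuous_on UNIV (\<lambda>(x, y). H x y)"
  shows "(\<integral>x. \<integral>y. H x y \<partial>N \<partial>M) = (\<integral>y. \<integral>x. H x y \<partial>M \<partial>N)"
proof -
  interpret M: compact_borel_prob M by fact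
  interpret N: compact_borel_prob N by fact
  note H' = continuous_swap[OF H]
  have i: "integrable N (H x)" for x
    by (intro N.integrable_continuous continuous_slice[OF H])
  have "dist (\<integral>x. \<integral>y. H x y \<partial>N \<partial>M) (\<integral>y. \<integral>x. H x y \<partial>M \<partial>N) \<le> e" if "e > 0" for e
  proof -
    obtain n :: nat and p A where A: "\<And>i. A i \<in> sets borel" "disjoint_family A" "(\<Union>i<n. A i) = UNIV"
        and close: "\<And>i x y. i < n \<Longrightarrow> x \<in> A i \<Longrightarrow> dist (H x y) (H (p i) y) \<le> e / 2"
      using uniform_partition[OF H M.compact_space N.compact_space, of "e / 2"] \<open>e > 0\<close>
      by (metis half_gt_zero)
    let ?S = "\<lambda>y. \<Sum>i<n. measure M (A i) * H (p i) y"
    have "dist (integral\<^sup>L N (H x)) (integral\<^sup>L N (H (p j))) \<le> e / 2" if "j < n" "x \<in> A j" for j x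
    proof -
      have "norm (\<integral>y. H x y - H (p j) y \<partial>N) \<le> e / 2"
        using close[OF that] i
        by (intro N.norm_integral_le Bochner_Integration.integrable_diff) (auto simp: dist_norm)
      then show ?thesis by (simp add: dist_norm i)
    qed
    then have "norm ((\<integral>x. \<integral>y. H x y \<partial>N \<partial>M) - (\<Sum>i<n. measure M (A i) * integral\<^sup>L N (H (p i)))) \<le> e / 2"
      using A by (intro M.riemann_sum N.continuous_on_integral H)
    moreover have "(\<Sum>i<n. measure M (A i) * integral\<^sup>L N (H (p i))) = integral\<^sup>L N ?S"
      by (subst Bochner_Integration.integral_sum) (auto simp: i)
    moreover have "norm (integral\<^sup>L N ?S - (\<integral>y. \<integral>x. H x y \<partial>M \<partial>N)) \<le> e / 2"
    proof -
      have c: "integrable N (\<lambda>y. \<integral>x. H x y \<partial>M)"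
        by (intro N.integrable_continuous M.continuous_on_integral H')
      have s: "integrable N ?S"
        using i by auto
      have "norm (\<integral>y. (\<integral>x. H x y \<partial>M) - ?S y \<partial>N) \<le> e / 2"
      proof (intro N.norm_integral_le Bochner_Integration.integrable_diff c s)
        show "norm ((\<integral>x. H x y \<partial>M) - ?S y) \<le> e / 2" for y
          using A close by (intro M.riemann_sum continuous_slice[OF H]) auto
      qed
      then show ?thesis using c s by (simp add: norm_minus_commute)
    qed
    ultimately show ?thesis
      using norm_diff_triangle_le[of _ "integral\<^sup>L N ?S" "e / 2" _ "e / 2"] by (simp add: dist_norm)
  qed
  then show ?thesis
    by (metis dist_le_zero_iff field_le_epsilon add_0)
qed

text \<open>Stated for kernels of two variables because the points will also be pairs, or carry
  weights and an adjoined extra point, where the kernel is no longer a function of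
  \<open>- x + y\<close>.\<close>

definition psd_kernel :: "('a \<Rightarrow> 'a \<Rightarrow> complex) \<Rightarrow> bool" where
  "psd_kernel H \<longleftrightarrow> (\<forall>(n::nat) (x::nat \<Rightarrow> 'a) (c::nat \<Rightarrow> complex).
     (\<Sum>j<n. \<Sum>k<n. H (x j) (x k) * c j * cnj (c k)) \<ge> 0)"

lemma psd_kernel_sum:
  assumes "psd_kernel H" and "finite I"
  shows "(\<Sum>j\<in>I. \<Sum>k\<in>I. H (x j) (x k) * c j * cnj (c k)) \<ge> 0"
proof -
  obtain q where q: "bij_betw q {..<card I} I"
    using ex_bij_betw_nat_finite[OF assms(2)] by (auto simp: lessThan_atLeast0)
  have "(\<Sum>j\<in>I. \<Sum>k\<in>I. H (x j) (x k) * c j * cnj (c k)) =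
      (\<Sum>j<card I. \<Sum>k<card I. H (x (q j)) (x (q k)) * c (q j) * cnj (c (q k)))"
    by (simp add: sum.reindex_bij_betw[OF q, symmetric])
  then show ?thesis
    using assms(1)[unfolded psd_kernel_def, rule_format, where x = "\<lambda>j. x (q j)" and c = "\<lambda>j. c (q j)"]
    by simp
qed

text \<open>With the cell measures as weights, the Riemann sum of the double integral is itself one
  of the quadratic forms known to be nonnegative.\<close>

lemma (in compact_borel_prob) psd_kernel_integral:
  assumes H: "continuous_on UNIV (\<lambda>(x, y). H x y)" and "psd_kernel H"
  shows "(\<integral>x. \<integral>y. H x y \<partial>M \<partial>M) \<ge> 0"
proof -
  let ?I = "\<integral>x. \<integral>y. H x y \<partial>M \<partial>M"
  have i: "integrable M (H x)" for x
    by (intro integrable_continuous continuous_slice[OF H])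
  have *: "\<exists>s\<ge>0. norm (?I - s) \<le> e" if "e > 0" for e
  proof -
    \<comment> \<open>Both variables are discretised by the same cells, so a single partition has to
      control \<open>H\<close> in its first and in its second argument; pairing \<open>H x y\<close>
      with \<open>H y x\<close> achieves this.\<close>
    have "continuous_on UNIV (\<lambda>(x, y). (H x y, H y x))"
      using continuous_on_Pair[OF H continuous_swap[OF H]] by (simp add: split_beta)
    then obtain n :: nat and p A where A: "\<And>i. A i \<in> sets borel" "disjoint_family A" "(\<Union>i<n. A i) = UNIV"
        and close: "\<And>i x y. i < n \<Longrightarrow> x \<in> A i \<Longrightarrow> dist (H x y, H y x) (H (p i) y, H y (p i)) \<le> e / 2"
      by (rule uniform_partition[OF _ compact_space compact_space half_gt_zero[OF \<open>e > 0\<close>]]) (rule that)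
    have close1: "dist (H x y) (H (p i) y) \<le> e / 2" and close2: "dist (H y x) (H y (p i)) \<le> e / 2"
      if "i < n" "x \<in> A i" for i x y
      using close[OF that, of y] dist_fst_le[of "(H x y, H y x)" "(H (p i) y, H y (p i))"]
        dist_snd_le[of "(H x y, H y x)" "(H (p i) y, H y (p i))"] by auto
    have m1: "(\<Sum>i<n. measure M (A i)) = 1"
      using finite_measure_finite_Union[of "{..<n}" A] A measure_UNIV
      by (auto simp: sets_borel disjoint_family_on_def)
    let ?m = "\<lambda>i. complex_of_real (measure M (A i))"
    let ?S = "\<Sum>i<n. \<Sum>j<n. H (p i) (p j) * ?m i * cnj (?m j)"
    have "dist (integral\<^sup>L M (H x)) (integral\<^sup>L M (H (p j))) \<le> e / 2" if "j < n" "x \<in> A j" for j x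
    proof -
      have "norm (\<integral>y. H x y - H (p j) y \<partial>M) \<le> e / 2"
        using close1[OF that] i
        by (intro norm_integral_le Bochner_Integration.integrable_diff) (auto simp: dist_norm)
      then show ?thesis by (simp add: dist_norm i)
    qed
    then have 1: "norm (?I - (\<Sum>i<n. ?m i * integral\<^sup>L M (H (p i)))) \<le> e / 2"
      using A by (intro riemann_sum continuous_on_integral H)
    have 2: "norm (integral\<^sup>L M (H (p i)) - (\<Sum>j<n. ?m j * H (p i) (p j))) \<le> e / 2" for i
      using A close2 by (intro riemann_sum continuous_slice[OF H])
    have "norm ((\<Sum>i<n. ?m i * integral\<^sup>L M (H (p i))) - ?S)
        = norm (\<Sum>i<n. ?m i * (integral\<^sup>L M (H (p i)) - (\<Sum>j<n. ?m j * H (p i) (p j))))"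
      by (simp add: sum_subtractf right_diff_distrib sum_distrib_left mult_ac)
    also have "\<dots> \<le> (\<Sum>i<n. measure M (A i) * (e / 2))"
      by (intro sum_norm_le, simp only: norm_mult norm_of_real, intro mult_mono 2, auto)
    also have "\<dots> = e / 2"
      by (simp only: sum_distrib_right[symmetric] m1 mult_1)
    finally have "norm (?I - ?S) \<le> e"
      using norm_diff_triangle_le[OF 1, of ?S "e / 2"] by simp
    moreover have "?S \<ge> 0"
      using assms(2) by (intro psd_kernel_sum) auto
    ultimately show ?thesis by blast
  qed
  have "- Re ?I \<le> e" and "\<bar>Im ?I\<bar> \<le> e" if "e > 0" for e
  proof -
    obtain s where "s \<ge> 0" "norm (?I - s) \<le> e" using *[OF \<open>e > 0\<close>] by blast
    then show "- Re ?I \<le> e" and "\<bar>Im ?I\<bar> \<le> e"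
      using abs_Re_le_cmod[of "?I - s"] abs_Im_le_cmod[of "?I - s"] by (auto simp: less_eq_complex_def)
  qed
  then have "- Re ?I \<le> 0" and "\<bar>Im ?I\<bar> \<le> 0"
    using field_le_epsilon[of "- Re ?I" 0] field_le_epsilon[of "\<bar>Im ?I\<bar>" 0] by simp_all
  then show ?thesis by (simp add: less_eq_complex_def)
qed

section \<open>Convolution on a compact group\<close>

locale compact_group_haar = compact_borel_prob M
  for M :: "'g::{topological_group_add, t2_space} measure" +
  assumes left_invariant:
    "A \<in> sets borel \<Longrightarrow> emeasure M ((\<lambda>y. g + y) ` A) = emeasure M A"
begin

abbreviation ip :: "('g \<Rightarrow> complex) \<Rightarrow> ('g \<Rightarrow> complex) \<Rightarrow> complex" where
  "ip f g \<equiv> (\<integral>x. f x * cnj (g x) \<partial>M)"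

abbreviation sq :: "('g \<Rightarrow> complex) \<Rightarrow> real" where
  "sq f \<equiv> (\<integral>x. (cmod (f x))\<^sup>2 \<partial>M)"

abbreviation conv :: "('g \<Rightarrow> complex) \<Rightarrow> ('g \<Rightarrow> complex) \<Rightarrow> 'g \<Rightarrow> complex" where
  "conv \<equiv> convolution M"

end

definition star :: "('g::group_add \<Rightarrow> complex) \<Rightarrow> 'g \<Rightarrow> complex" where
  "star f = (\<lambda>x. cnj (f (- x)))"

lemmas group_simps = add.assoc minus_add

lemma continuous_comp:
  "continuous_on UNIV f \<Longrightarrow> continuous_on S g \<Longrightarrow> continuous_on S (\<lambda>x. f (g x))"
  by (erule (1) continuous_on_compose2) simp

lemma continuous_star:
  fixes f :: "'g::topological_group_add \<Rightarrow> complex"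
  assumes "continuous_on UNIV f"
  shows "continuous_on UNIV (star f)"
  unfolding star_def by (intro continuous_intros continuous_comp[OF assms])

context compact_group_haar
begin

section \<open>Invariance of the integral and the mean-square inner product\<close>

lemma integral_translate_left:
  fixes h :: "'g \<Rightarrow> 'b::{banach, second_countable_topology}"
  assumes "continuous_on UNIV h"
  shows "(\<integral>x. h (g + x) \<partial>M) = integral\<^sup>L M h"
proof -
  have m: "(\<lambda>y. g + y) \<in> measurable M borel"
    by (intro borel_measurable_continuous continuous_intros)
  have "distr M borel (\<lambda>y. g + y) = M"
  proof (rule measure_eqI)
    fix A assume "A \<in> sets (distr M borel (\<lambda>y. g + y))"
    then have A: "A \<in> sets borel" by simp
    have "(\<lambda>y. g + y) -` A = (\<lambda>y. - g + y) ` A"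
      by (force simp: image_iff add.assoc[symmetric])
    then show "emeasure (distr M borel (\<lambda>y. g + y)) A = emeasure M A"
      using left_invariant[OF A, of "- g"] by (simp add: emeasure_distr[OF m A] space_UNIV)
  qed (simp add: sets_borel)
  then show ?thesis
    using integral_distr[OF m, of h] borel_measurable_continuous_onI[OF assms] by simp
qed

text \<open>The double integral of \<open>h (- x + y)\<close> is evaluated in both orders:
  integrating over \<open>y\<close> first gives the integral of \<open>h\<close>, integrating over
  \<open>x\<close> first gives that of \<open>h (- x)\<close>, each time by left invariance
  alone.\<close>

lemma integral_uminus:
  fixes h :: "'g \<Rightarrow> complex"
  assumes "continuous_on UNIV h"
  shows "(\<integral>x. h (- x) \<partial>M) = integral\<^sup>L M h"
proof -
  have c: "continuous_on UNIV (\<lambda>(x, y). h (- x + y))"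
    by (auto simp: split_beta intro!: continuous_intros continuous_comp[OF assms])
  have "continuous_on UNIV (\<lambda>x. h (- x))"
    by (intro continuous_intros continuous_comp[OF assms])
  from integral_translate_left[OF this]
  have "(\<integral>x. h (- (- y + x)) \<partial>M) = (\<integral>x. h (- x) \<partial>M)" for y .
  then have "(\<integral>x. h (- x + y) \<partial>M) = (\<integral>x. h (- x) \<partial>M)" for y
    by (simp only: minus_add minus_minus)
  then have "(\<integral>x. h (- x) \<partial>M) = (\<integral>y. \<integral>x. h (- x + y) \<partial>M \<partial>M)"
    by (simp only: integral_const)
  also have "\<dots> = (\<integral>x. \<integral>y. h (- x + y) \<partial>M \<partial>M)"
    by (intro integral_swap[symmetric] compact_borel_prob_axioms c)
  also have "\<dots> = integral\<^sup>L M h"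
    by (simp only: integral_translate_left[OF assms] integral_const)
  finally show ?thesis .
qed

text \<open>The set where \<open>h\<close> is nonzero is open and null. Were it nonempty, finitely
  many of its translates, all null, would cover the compact group, against total mass 1.\<close>

lemma integral_eq_0_imp_eq_0:
  fixes h :: "'g \<Rightarrow> real"
  assumes "continuous_on UNIV h" and "\<And>x. h x \<ge> 0" and "integral\<^sup>L M h = 0"
  shows "h x = 0"
proof (rule ccontr)
  assume "h x \<noteq> 0"
  define U where "U = {y. h y \<noteq> 0}"
  have U: "open U"
    unfolding U_def using assms(1) by (intro open_Collect_neq) auto
  have "AE y in M. h y = 0"
    using integral_nonneg_eq_0_iff_AE[OF integrable_continuous[OF assms(1)]] assms by auto
  then have "emeasure M U = 0"
    using U by (subst AE_iff_measurable[symmetric, of U M "\<lambda>y. h y = 0"])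
      (auto simp: U_def sets_borel space_UNIV)
  then have null: "emeasure M ((\<lambda>y. g + y) ` U) = 0" for g
    using left_invariant U by simp
  have vim: "(\<lambda>y. g + y) ` U = (\<lambda>y. - g + y) -` U" for g
    by (force simp: image_iff add.assoc[symmetric])
  have op: "open ((\<lambda>y. g + y) ` U)" for g
    unfolding vim by (intro open_vimage U continuous_intros)
  have "y \<in> (\<lambda>z. (y - x) + z) ` U" for y
    using \<open>h x \<noteq> 0\<close> by (auto simp: U_def image_iff)
  then have "UNIV \<subseteq> (\<Union>g\<in>UNIV. (\<lambda>y. g + y) ` U)"
    by blast
  then obtain C where C: "finite C" "UNIV \<subseteq> (\<Union>g\<in>C. (\<lambda>y. g + y) ` U)"
    by (rule compactE_image[OF compact_space op]) (rule that)
  have "emeasure M UNIV \<le> emeasure M (\<Union>g\<in>C. (\<lambda>y. g + y) ` U)"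
    using C op by (intro emeasure_mono) (auto simp: sets_borel)
  also have "\<dots> \<le> (\<Sum>g\<in>C. emeasure M ((\<lambda>y. g + y) ` U))"
    using C op by (intro emeasure_subadditive_finite) (auto simp: sets_borel)
  finally show False
    by (simp add: null total_mass)
qed

lemma ip_self: "continuous_on UNIV f \<Longrightarrow> ip f f = complex_of_real (sq f)"
  by (subst integral_complex_of_real[symmetric]) (simp add: complex_norm_square del: of_real_power)

lemma sq_nonneg: "sq f \<ge> 0"
  by (intro Bochner_Integration.integral_nonneg) auto

lemma sq_eq_0_imp: "continuous_on UNIV f \<Longrightarrow> sq f = 0 \<Longrightarrow> f x = 0"
  using integral_eq_0_imp_eq_0[of "\<lambda>x. (cmod (f x))\<^sup>2" x]
  by (simp add: continuous_on_power continuous_on_norm)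

lemma sq_le: "continuous_on UNIV f \<Longrightarrow> (\<And>x. (cmod (f x))\<^sup>2 \<le> c) \<Longrightarrow> sq f \<le> c"
  using norm_integral_le[of "\<lambda>x. (cmod (f x))\<^sup>2" c]
  by (simp add: integrable_continuous continuous_on_power continuous_on_norm)

lemma cauchy_schwarz:
  assumes f: "continuous_on UNIV f" and g: "continuous_on UNIV g"
  shows "(cmod (ip f g))\<^sup>2 \<le> sq f * sq g"
proof -
  define C where "C = (\<integral>x. cmod (f x) * cmod (g x) \<partial>M)"
  have i: "integrable M (\<lambda>x. (cmod (f x))\<^sup>2)" "integrable M (\<lambda>x. (cmod (g x))\<^sup>2)"
      "integrable M (\<lambda>x. cmod (f x) * cmod (g x))"
    by (intro integrable_continuous continuous_intros f g)+
  have 1: "cmod (ip f g) \<le> C"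
    using integral_norm_bound[of M "\<lambda>x. f x * cnj (g x)"] by (simp add: C_def norm_mult)
  have 2: "0 \<le> sq f * t\<^sup>2 - 2 * t * C + sq g" for t
  proof -
    have "0 \<le> (\<integral>x. (t * cmod (f x) - cmod (g x))\<^sup>2 \<partial>M)"
      by (intro Bochner_Integration.integral_nonneg) auto
    also have "\<dots> = (\<integral>x. t\<^sup>2 * (cmod (f x))\<^sup>2 - (2 * t) * (cmod (f x) * cmod (g x)) + (cmod (g x))\<^sup>2 \<partial>M)"
      by (intro Bochner_Integration.integral_cong) (auto simp: power2_eq_square algebra_simps)
    also have "\<dots> = sq f * t\<^sup>2 - 2 * t * C + sq g"
      using i by (simp add: C_def)
    finally show ?thesis .
  qed
  have "C\<^sup>2 \<le> sq f * sq g"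
  \<comment> \<open>The parabola is tested at its minimiser \<open>C / sq f\<close>. If
    \<open>sq f = 0\<close> it is linear in \<open>t\<close>, and the chosen \<open>t\<close> would
    give it the value -1 unless \<open>C = 0\<close>.\<close>
  proof (cases "sq f = 0")
    case True
    then have "C = 0"
      using 2[of "(sq g + 1) / (2 * C)"] by (cases "C = 0") auto
    then show ?thesis using True by simp
  next
    case False
    then have "sq f > 0" using sq_nonneg[of f] by linarith
    then show ?thesis
      using 2[of "C / sq f"] by (simp add: field_simps power2_eq_square)
  qed
  moreover have "(cmod (ip f g))\<^sup>2 \<le> C\<^sup>2"
    using 1 by (intro power_mono) auto
  ultimately show ?thesis by linarith
qed

lemma sq_star: "continuous_on UNIV f \<Longrightarrow> sq (star f) = sq f"
  using integral_uminus[of "\<lambda>x. complex_of_real ((cmod (f x))\<^sup>2)"]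
  by (simp add: star_def continuous_intros flip: of_real_power)

section \<open>Convolution: norm estimates and algebraic laws\<close>

lemma convolution_eq_ip: "conv f g x = ip f (\<lambda>y. star g (- x + y))"
  by (simp add: convolution_def star_def minus_add del: add_uminus_conv_diff)

lemma continuous_convolution_integrand:
  fixes f g :: "'g \<Rightarrow> complex"
  assumes "continuous_on UNIV f" and "continuous_on UNIV g"
  shows "continuous_on UNIV (\<lambda>(x, y). f y * g (- y + x))"
  unfolding split_beta
  by (intro continuous_intros continuous_comp[OF assms(1)] continuous_comp[OF assms(2)])

lemma continuous_convolution:
  assumes "continuous_on UNIV f" and "continuous_on UNIV g"
  shows "continuous_on UNIV (conv f g)"
  using continuous_on_integral[OF continuous_convolution_integrand[OF assms]]
  by (simp add: convolution_def[abs_def])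

lemma integrable_convolution:
  fixes f g :: "'g \<Rightarrow> complex"
  assumes "continuous_on UNIV f" and "continuous_on UNIV g"
  shows "integrable M (\<lambda>y. f y * g (- y + x))"
  by (intro integrable_continuous continuous_intros assms continuous_comp[OF assms(2)])

text \<open>Left translation and \<open>star\<close> preserve the mean square, so the
  Cauchy--Schwarz bound does not depend on \<open>x\<close>. This is what turns mean-square control
  into uniform control.\<close>

lemma norm_convolution_le:
  assumes f: "continuous_on UNIV f" and g: "continuous_on UNIV g"
  shows "(cmod (conv f g x))\<^sup>2 \<le> sq f * sq g"
proof -
  have "(cmod (conv f g x))\<^sup>2 \<le> sq f * sq (\<lambda>y. star g (- x + y))"
    unfolding convolution_eq_ip
    by (intro cauchy_schwarz f continuous_comp[OF continuous_star[OF g]] continuous_intros)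
  also have "sq (\<lambda>y. star g (- x + y)) = sq (star g)"
    by (intro integral_translate_left[of "\<lambda>y. (cmod (star g y))\<^sup>2"] continuous_intros continuous_star g)
  finally show ?thesis
    by (simp add: sq_star g)
qed

lemma sq_convolution_le:
  assumes f: "continuous_on UNIV f" and g: "continuous_on UNIV g"
  shows "sq (conv f g) \<le> sq f * sq g"
  by (intro sq_le continuous_convolution f g norm_convolution_le)

lemma convolution_star_0: "conv f (star g) 0 = ip f g"
  by (simp add: convolution_def star_def)

lemma convolution_assoc:
  assumes f: "continuous_on UNIV f" and g: "continuous_on UNIV g" and h: "continuous_on UNIV h"
  shows "conv (conv f g) h = conv f (conv g h)"
proof
  fix x
  have "conv (conv f g) h x = (\<integral>y. \<integral>z. f z * g (- z + y) * h (- y + x) \<partial>M \<partial>M)"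
    by (simp add: convolution_def)
  also have "\<dots> = (\<integral>z. \<integral>y. f z * g (- z + y) * h (- y + x) \<partial>M \<partial>M)"
    unfolding split_beta
    by (intro integral_swap compact_borel_prob_axioms, unfold split_beta,
        intro continuous_intros continuous_comp[OF f] continuous_comp[OF g] continuous_comp[OF h])
  also have "\<dots> = (\<integral>z. f z * conv g h (- z + x) \<partial>M)"
  proof (intro Bochner_Integration.integral_cong refl)
    fix z
    have "(\<integral>y. g (- z + y) * h (- y + x) \<partial>M) = (\<integral>y. g (- z + (z + y)) * h (- (z + y) + x) \<partial>M)"
      by (intro integral_translate_left[symmetric, of "\<lambda>y. g (- z + y) * h (- y + x)"]
          continuous_intros continuous_comp[OF g] continuous_comp[OF h])
    then show "(\<integral>y. f z * g (- z + y) * h (- y + x) \<partial>M) = f z * conv g h (- z + x)"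
      by (simp add: convolution_def group_simps mult.assoc del: add_uminus_conv_diff)
  qed
  finally show "conv (conv f g) h x = conv f (conv g h) x"
    by (simp add: convolution_def)
qed

lemma star_convolution:
  assumes f: "continuous_on UNIV f" and g: "continuous_on UNIV g"
  shows "star (conv f g) = conv (star g) (star f)"
proof
  fix x
  have "conv (star g) (star f) x = cnj (\<integral>y. g (- y) * f (- x + y) \<partial>M)"
    by (simp add: convolution_def star_def minus_add flip: complex_cnj_mult del: add_uminus_conv_diff)
  also have "(\<integral>y. g (- y) * f (- x + y) \<partial>M) = (\<integral>y. g (- (x + y)) * f (- x + (x + y)) \<partial>M)"
    by (intro integral_translate_left[symmetric, of "\<lambda>y. g (- y) * f (- x + y)"]
        continuous_intros continuous_comp[OF g] continuous_comp[OF f])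
  also have "\<dots> = conv f g (- x)"
    by (simp add: convolution_def minus_add mult.commute flip: add.assoc del: add_uminus_conv_diff)
  finally show "star (conv f g) x = conv (star g) (star f) x"
    by (simp add: star_def)
qed

lemma convolution_scale_left: "conv (\<lambda>x. c * f x) g = (\<lambda>x. c * conv f g x)"
  by (simp add: convolution_def fun_eq_iff mult.assoc)

lemma convolution_scale_right: "conv f (\<lambda>x. c * g x) = (\<lambda>x. c * conv f g x)"
  by (simp add: convolution_def fun_eq_iff mult.left_commute)

lemma convolution_add_left:
  assumes "continuous_on UNIV f" and "continuous_on UNIV g" and "continuous_on UNIV h"
  shows "conv (\<lambda>x. f x + g x) h = (\<lambda>x. conv f h x + conv g h x)"
  using integrable_convolution[OF assms(1,3)] integrable_convolution[OF assms(2,3)]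
  by (simp add: convolution_def fun_eq_iff ring_distribs)

lemma convolution_diff_left:
  assumes "continuous_on UNIV f" and "continuous_on UNIV g" and "continuous_on UNIV h"
  shows "conv (\<lambda>x. f x - g x) h = (\<lambda>x. conv f h x - conv g h x)"
  using integrable_convolution[OF assms(1,3)] integrable_convolution[OF assms(2,3)]
  by (simp add: convolution_def fun_eq_iff ring_distribs)

lemma convolution_tendsto:
  assumes "\<And>n. continuous_on UNIV (W n)" and lim: "uniform_limit UNIV W P sequentially"
    and "continuous_on UNIV h"
  shows "(\<lambda>n. conv (W n) h x) \<longlonglongrightarrow> conv P h x"
proof -
  have P: "continuous_on UNIV P"
    by (rule uniform_limit_theorem[OF _ lim]) (use assms(1) in auto)
  have "bounded (range h)"
    by (intro compact_imp_bounded compact_continuous_image assms compact_space)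
  then obtain b where b: "b > 0" "\<And>x. norm (h x) \<le> b"
    by (auto simp: bounded_pos)
  show ?thesis
  proof (rule tendstoI)
    fix e :: real assume e: "e > 0"
    have "\<forall>\<^sub>F n in sequentially. \<forall>y\<in>UNIV. dist (W n y) (P y) < e / (2 * b)"
      using lim e b by (auto simp: uniform_limit_iff)
    then show "\<forall>\<^sub>F n in sequentially. dist (conv (W n) h x) (conv P h x) < e"
    proof eventually_elim
      case (elim n)
      have "norm (\<integral>y. W n y * h (- y + x) - P y * h (- y + x) \<partial>M) \<le> e / 2"
      proof (intro norm_integral_le Bochner_Integration.integrable_diff integrable_convolution assms P)
        fix y
        have "norm (W n y * h (- y + x) - P y * h (- y + x)) = dist (W n y) (P y) * norm (h (- y + x))"
          by (simp add: dist_norm left_diff_distrib[symmetric] norm_mult)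
        also have "\<dots> \<le> (e / (2 * b)) * b"
          using elim b by (intro mult_mono) (auto intro: less_imp_le simp: e)
        finally show "norm (W n y * h (- y + x) - P y * h (- y + x)) \<le> e / 2"
          using b by simp
      qed
      then show ?case
        using e integrable_convolution[OF assms(1,3)] integrable_convolution[OF P assms(3)]
        by (simp add: convolution_def dist_norm)
    qed
  qed
qed

end

section \<open>Positive definite spherical functions\<close>

lemma pos_def_psd_kernel: "pos_def g \<Longrightarrow> psd_kernel (\<lambda>x y. g (- x + y))"
  by (simp add: pos_def_def psd_kernel_def)

lemma pos_def_pair:
  assumes "pos_def g"
  shows "0 \<le> g 0 * (a * cnj a + b * cnj b) + g x * a * cnj b + g (- x) * b * cnj a"
proof -
  have "0 \<le> (\<Sum>j<(2::nat). \<Sum>k<(2::nat). g (- (if j = 0 then 0 else x) + (if k = 0 then 0 else x)) *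
      (if j = 0 then a else b) * cnj (if k = 0 then a else b))"
    using assms unfolding pos_def_def by (elim conjE allE[of _ 2] allE[of _ "\<lambda>j. if j = 0 then 0 else x"]
      allE[of _ "\<lambda>j. if j = 0 then a else b"])
  then show ?thesis
    by (simp add: numeral_2_eq_2 algebra_simps)
qed

lemma pos_def_at_0: "pos_def g \<Longrightarrow> g 0 \<ge> 0"
  using pos_def_pair[of g 1 0 0] by simp

text \<open>In the form at the points \<open>0\<close> and \<open>x\<close>, the weights
  \<open>1, 1\<close> make the imaginary part of \<open>g x + g (- x)\<close> vanish, and the
  weights \<open>1, \<i>\<close> make the real parts agree.\<close>

lemma pos_def_uminus:
  assumes "pos_def g"
  shows "g (- x) = cnj (g x)"
  using pos_def_pair[OF assms, of 1 1 x] pos_def_pair[OF assms, of 1 \<i> x] pos_def_at_0[OF assms]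
  by (simp add: less_eq_complex_def complex_eq_iff)

text \<open>The weights \<open>1\<close> and \<open>- sgn (g x)\<close> rotate both off-diagonal
  terms to \<open>- cmod (g x)\<close>, leaving
  \<open>2 * Re (g 0) - 2 * cmod (g x)\<close>.\<close>

lemma norm_pos_def_le:
  assumes "pos_def g"
  shows "cmod (g x) \<le> Re (g 0)"
proof (cases "g x = 0")
  case True
  then show ?thesis using pos_def_at_0[OF assms] by (simp add: less_eq_complex_def)
next
  case False
  have "0 \<le> Re (g 0 * (1 + sgn (g x) * cnj (sgn (g x))) - g x * cnj (sgn (g x)) - g (- x) * sgn (g x))"
    using pos_def_pair[OF assms, of 1 "- sgn (g x)" x] by (simp add: less_eq_complex_def)
  also have "sgn (g x) * cnj (sgn (g x)) = 1"
    using False by (simp add: complex_norm_square[symmetric] norm_sgn)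
  also have "g x * cnj (sgn (g x)) = cmod (g x)"
  proof -
    have "g x * cnj (sgn (g x)) = (g x * cnj (g x)) / cmod (g x)"
      by (simp add: sgn_eq)
    then show ?thesis
      using False by (simp add: complex_norm_square[symmetric] power2_eq_square)
  qed
  also have "g (- x) * sgn (g x) = cmod (g x)"
    using arg_cong[OF \<open>g x * cnj (sgn (g x)) = cmod (g x)\<close>, of cnj] pos_def_uminus[OF assms]
    by simp
  finally show ?thesis by simp
qed

lemma (in compact_borel_prob) integral_complex_nonneg:
  assumes "continuous_on UNIV h" and "\<And>x. h x \<ge> (0 :: complex)"
  shows "integral\<^sup>L M h \<ge> 0"
  using integrable_continuous[OF assms(1)] assms(2)
  by (auto simp: less_eq_complex_def integral_Re[symmetric] integral_Im[symmetric] simp del: integral_Re integral_Im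
      intro!: Bochner_Integration.integral_nonneg)

context compact_group_haar
begin

lemma ip_cnj: "cnj (ip f g) = ip g f"
  by (subst Bochner_Integration.integral_cnj[symmetric]) (simp add: mult.commute)

lemma integrable_ip: "continuous_on UNIV f \<Longrightarrow> continuous_on UNIV g \<Longrightarrow> integrable M (\<lambda>x. f x * cnj (g x))"
  by (intro integrable_continuous continuous_intros)

lemma ip_diff_left:
  assumes "continuous_on UNIV f" and "continuous_on UNIV g" and "continuous_on UNIV h"
  shows "ip (\<lambda>x. f x - g x) h = ip f h - ip g h"
  using integrable_ip[OF assms(1,3)] integrable_ip[OF assms(2,3)] by (simp add: left_diff_distrib)

lemma ip_diff_right:
  assumes "continuous_on UNIV f" and "continuous_on UNIV g" and "continuous_on UNIV h"
  shows "ip h (\<lambda>x. f x - g x) = ip h f - ip h g"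
  using integrable_ip[OF assms(3,1)] integrable_ip[OF assms(3,2)] by (simp add: right_diff_distrib)

lemma ip_sum_left:
  assumes "\<And>i. i \<in> I \<Longrightarrow> continuous_on UNIV (e i)" and "continuous_on UNIV h"
  shows "ip (\<lambda>x. \<Sum>i\<in>I. a i * e i x) h = (\<Sum>i\<in>I. a i * ip (e i) h)"
  using integrable_ip[OF assms] by (simp add: sum_distrib_right mult.assoc)

lemma ip_sum_right:
  assumes "\<And>i. i \<in> I \<Longrightarrow> continuous_on UNIV (e i)" and "continuous_on UNIV h"
  shows "ip h (\<lambda>x. \<Sum>i\<in>I. a i * e i x) = (\<Sum>i\<in>I. cnj (a i) * ip h (e i))"
proof -
  have "ip h (\<lambda>x. \<Sum>i\<in>I. a i * e i x) = (\<integral>x. (\<Sum>i\<in>I. cnj (a i) * (h x * cnj (e i x))) \<partial>M)"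
    by (simp add: sum_distrib_left mult.left_commute)
  also have "\<dots> = (\<Sum>i\<in>I. cnj (a i) * ip h (e i))"
    using integrable_ip[OF assms(2,1)] by simp
  finally show ?thesis .
qed

end

text \<open>\<open>N\<close> stands for the Haar measure of \<open>K\<close> pushed forward to the
  whole group, so that it fits \<open>compact_borel_prob\<close>. Its origin survives only as
  concentration on \<open>K\<close> and as invariance for integrals of continuous functions.\<close>

locale compact_gelfand_pair = compact_group_haar M
  for M :: "'g::{topological_group_add, t2_space} measure" +
  fixes N :: "'g measure" and K :: "'g set"
  assumes prob_N: "compact_borel_prob N"
    and N_supported: "AE k in N. k \<in> K"
    and N_invariant: "\<And>h :: 'g \<Rightarrow> complex. \<And>l. continuous_on UNIV h \<Longrightarrow> l \<in> K \<Longrightarrow>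
          (\<integral>k. h (l + k) \<partial>N) = integral\<^sup>L N h"
    and K_zero: "0 \<in> K" and K_uminus: "k \<in> K \<Longrightarrow> - k \<in> K"
    and convolution_commute: "\<And>f g. continuous_on UNIV f \<Longrightarrow> bi_invariant K f \<Longrightarrow>
          continuous_on UNIV g \<Longrightarrow> bi_invariant K g \<Longrightarrow> conv f g = conv g f"
begin

sublocale N: compact_borel_prob N
  by (rule prob_N)

lemma bi_invariantD:
  assumes "bi_invariant K f"
  shows "k \<in> K \<Longrightarrow> f (k + x) = f x" and "k \<in> K \<Longrightarrow> f (x + k) = f x"
  using assms K_zero unfolding bi_invariant_def by (metis add.right_neutral, metis add.left_neutral)

lemma bi_invariantI:
  assumes "\<And>k x. k \<in> K \<Longrightarrow> f (k + x) = f x" and "\<And>k x. k \<in> K \<Longrightarrow> f (x + k) = f x"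
  shows "bi_invariant K f"
  using assms by (simp add: bi_invariant_def)

text \<open>After exchanging the integrals, translating \<open>z\<close> by \<open>k\<close> removes
  \<open>k\<close> from \<open>G\<close>, and the invariant factor \<open>F\<close> does not notice.
  So \<open>F\<close> cannot distinguish \<open>G\<close> from its average over
  \<open>K\<close>.\<close>

lemma integral_average:
  fixes F G :: "'g \<Rightarrow> complex"
  assumes F: "continuous_on UNIV F" and G: "continuous_on UNIV G"
    and inv: "\<And>k x. k \<in> K \<Longrightarrow> F (k + x) = F x"
  shows "(\<integral>z. F z * (\<integral>k. G (k + z) \<partial>N) \<partial>M) = (\<integral>z. F z * G z \<partial>M)"
proof -
  have c: "continuous_on UNIV (\<lambda>(z, k). F z * G (k + z))"
    unfolding split_beta by (intro continuous_intros continuous_comp[OF F] continuous_comp[OF G])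
  have "(\<integral>z. F z * G (k + z) \<partial>M) = (\<integral>z. F z * G z \<partial>M)" if "k \<in> K" for k
    using integral_translate_left[of "\<lambda>z. F z * G z" k] inv[OF that] F G
    by (simp add: continuous_on_mult)
  then have "AE k in N. (\<integral>z. F z * G (k + z) \<partial>M) = (\<integral>z. F z * G z \<partial>M)"
    using N_supported by (auto elim!: eventually_mono)
  then have "(\<integral>k. \<integral>z. F z * G (k + z) \<partial>M \<partial>N) = (\<integral>k. \<integral>z. F z * G z \<partial>M \<partial>N)"
    using continuous_on_integral[OF continuous_swap[OF c]]
    by (intro integral_cong_AE N.borel_measurable_continuous continuous_on_const)
  then show ?thesis
    by (simp add: N.measure_UNIV N.space_UNIV integral_swap[OF compact_borel_prob_axioms prob_N c, symmetric])
qed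

section \<open>Spherical functions: invariance, orthogonality, reproducing kernel\<close>

lemma Zsph_continuous: "\<phi> \<in> Zsph N \<Longrightarrow> continuous_on UNIV \<phi>"
  and Zsph_pos_def: "\<phi> \<in> Zsph N \<Longrightarrow> pos_def \<phi>"
  and Zsph_0: "\<phi> \<in> Zsph N \<Longrightarrow> \<phi> 0 = 1"
  and Zsph_functional: "\<phi> \<in> Zsph N \<Longrightarrow> (\<integral>k. \<phi> (x + k + y) \<partial>N) = \<phi> x * \<phi> y"
  by (simp_all add: Zsph_def spherical_def)

lemma Zsph_uminus: "\<phi> \<in> Zsph N \<Longrightarrow> \<phi> (- x) = cnj (\<phi> x)"
  by (simp add: pos_def_uminus Zsph_pos_def)

lemma norm_Zsph_le: "\<phi> \<in> Zsph N \<Longrightarrow> cmod (\<phi> x) \<le> 1"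
  using norm_pos_def_le[of \<phi> x] by (simp add: Zsph_pos_def Zsph_0)

text \<open>Putting \<open>y = 0\<close> in the functional equation exhibits \<open>\<phi> x\<close>
  as the average of \<open>\<phi> (x + k)\<close>, which is right invariant because \<open>N\<close>
  is invariant. Left invariance follows by hermitian symmetry.\<close>

lemma Zsph_bi_invariant:
  assumes \<phi>: "\<phi> \<in> Zsph N"
  shows "bi_invariant K \<phi>"
proof -
  have right: "\<phi> (x + l) = \<phi> x" if "l \<in> K" for x l
  proof -
    have c: "continuous_on UNIV (\<lambda>k. \<phi> (x + k))"
      by (intro continuous_comp[OF Zsph_continuous[OF \<phi>]] continuous_intros)
    have "\<phi> (x + l) = (\<integral>k. \<phi> (x + (l + k)) \<partial>N)"
      using Zsph_functional[OF \<phi>, of "x + l" 0] by (simp add: Zsph_0 \<phi> add.assoc)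
    also have "\<dots> = \<phi> x"
      using N_invariant[OF c that] Zsph_functional[OF \<phi>, of x 0] by (simp add: Zsph_0 \<phi>)
    finally show ?thesis .
  qed
  have "\<phi> (l + x) = \<phi> x" if "l \<in> K" for x l
  proof -
    have "cnj (\<phi> (l + x)) = \<phi> (- x + - l)"
      by (simp only: Zsph_uminus[OF \<phi>, symmetric] minus_add)
    also have "\<dots> = cnj (\<phi> x)"
      by (simp only: right[OF K_uminus[OF that]] Zsph_uminus[OF \<phi>])
    finally show ?thesis by simp
  qed
  then show ?thesis
    using right by (intro bi_invariantI)
qed

text \<open>An invariant \<open>F\<close> sees only the \<open>K\<close>-average of the translate of
  \<open>\<psi>\<close>, and the functional equation factorises that average.\<close>

lemma ip_translate_Zsph:
  assumes \<psi>: "\<psi> \<in> Zsph N" and F: "continuous_on UNIV F"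
    and inv: "\<And>k x. k \<in> K \<Longrightarrow> F (k + x) = F x"
  shows "ip F (\<lambda>z. \<psi> (y + z)) = cnj (\<psi> y) * ip F \<psi>"
proof -
  have c: "continuous_on UNIV (\<lambda>z. cnj (\<psi> (y + z)))"
    by (intro continuous_intros continuous_comp[OF Zsph_continuous[OF \<psi>]])
  have "ip F (\<lambda>z. \<psi> (y + z)) = (\<integral>z. F z * (\<integral>k. cnj (\<psi> (y + (k + z))) \<partial>N) \<partial>M)"
    by (rule integral_average[OF F c inv, symmetric])
  also have "\<dots> = (\<integral>z. cnj (\<psi> y) * (F z * cnj (\<psi> z)) \<partial>M)"
    using Zsph_functional[OF \<psi>] by (simp add: add.assoc mult.left_commute)
  finally show ?thesis by simp
qed

lemma convolution_Zsph:
  assumes "\<psi> \<in> Zsph N" and "continuous_on UNIV F" and "bi_invariant K F"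
  shows "conv F \<psi> = (\<lambda>x. ip F \<psi> * \<psi> x)"
proof
  fix x
  have "star \<psi> = \<psi>"
    using assms(1) by (simp add: star_def Zsph_uminus fun_eq_iff)
  then show "conv F \<psi> x = ip F \<psi> * \<psi> x"
    using ip_translate_Zsph[OF assms(1,2), of "- x"] bi_invariantD[OF assms(3)]
    by (simp add: convolution_eq_ip Zsph_uminus assms)
qed

text \<open>The inner product of \<open>\<phi>\<close> with a translate of \<open>\<psi>\<close> is
  computed twice: by factoring \<open>\<psi>\<close> directly, and by first moving the translation
  to \<open>\<phi>\<close>. So \<open>ip \<phi> \<psi>\<close> takes both factors
  \<open>cnj (\<psi> y)\<close> and \<open>cnj (\<phi> y)\<close> with the same result, for every
  \<open>y\<close>.\<close>

lemma Zsph_orthogonal: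
  assumes \<phi>: "\<phi> \<in> Zsph N" and \<psi>: "\<psi> \<in> Zsph N" and "\<phi> \<noteq> \<psi>"
  shows "ip \<phi> \<psi> = 0"
proof (rule ccontr)
  assume nz: "ip \<phi> \<psi> \<noteq> 0"
  have "\<phi> y = \<psi> y" for y
  proof -
    have c: "continuous_on UNIV (\<lambda>z. \<phi> (- y + z) * cnj (\<psi> z))"
      by (intro continuous_intros continuous_comp[OF Zsph_continuous[OF \<phi>]] Zsph_continuous \<psi>)
    have "cnj (\<psi> y) * ip \<phi> \<psi> = ip \<phi> (\<lambda>z. \<psi> (y + z))"
      by (intro ip_translate_Zsph[symmetric] Zsph_continuous \<phi> \<psi> bi_invariantD Zsph_bi_invariant)
    also have "\<dots> = ip (\<lambda>z. \<phi> (- y + z)) \<psi>"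
      using integral_translate_left[OF c, of y] by (simp add: add.assoc[symmetric])
    also have "\<dots> = cnj (ip \<psi> (\<lambda>z. \<phi> (- y + z)))"
      by (rule ip_cnj[symmetric])
    also have "ip \<psi> (\<lambda>z. \<phi> (- y + z)) = cnj (\<phi> (- y)) * ip \<psi> \<phi>"
      by (intro ip_translate_Zsph Zsph_continuous \<phi> \<psi> bi_invariantD Zsph_bi_invariant)
    also have "cnj \<dots> = cnj (\<phi> y) * ip \<phi> \<psi>"
      by (simp add: ip_cnj Zsph_uminus[OF \<phi>] del: integral_cnj)
    finally show ?thesis using nz by simp
  qed
  then show False using \<open>\<phi> \<noteq> \<psi>\<close> by blast
qed

lemma sq_Zsph_pos: "\<phi> \<in> Zsph N \<Longrightarrow> sq \<phi> > 0"
  using sq_eq_0_imp[of \<phi> 0] sq_nonneg[of \<phi>] Zsph_continuous[of \<phi>] Zsph_0[of \<phi>] by (auto simp: less_le)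

lemma Zsph_reproducing:
  assumes \<phi>: "\<phi> \<in> Zsph N"
  shows "ip (\<lambda>y. \<phi> (- g + y)) (\<lambda>y. \<phi> (- x + y)) = complex_of_real (sq \<phi>) * \<phi> (- g + x)"
proof -
  have c: "continuous_on UNIV (\<lambda>y. \<phi> (- g + y) * cnj (\<phi> (- x + y)))"
    by (intro continuous_intros continuous_comp[OF Zsph_continuous[OF \<phi>]])
  have "ip (\<lambda>y. \<phi> (- g + y)) (\<lambda>y. \<phi> (- x + y)) = ip (\<lambda>y. \<phi> ((- g + x) + y)) \<phi>"
    using integral_translate_left[OF c, of x]
    by (simp add: add.assoc[symmetric])
  also have "\<dots> = cnj (ip \<phi> (\<lambda>y. \<phi> ((- g + x) + y)))"
    by (rule ip_cnj[symmetric])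
  also have "ip \<phi> (\<lambda>y. \<phi> ((- g + x) + y)) = cnj (\<phi> (- g + x)) * ip \<phi> \<phi>"
    by (intro ip_translate_Zsph Zsph_continuous \<phi> bi_invariantD Zsph_bi_invariant)
  also have "ip \<phi> \<phi> = sq \<phi>"
    by (intro ip_self Zsph_continuous \<phi>)
  finally show ?thesis by simp
qed

text \<open>A Schur product argument: by the reproducing formula,
  \<open>sq \<phi> * \<phi> (- x j + x k)\<close> is an integral over \<open>y\<close> of rank-one
  kernels \<open>?a j y * cnj (?a k y)\<close>, and for each \<open>y\<close> these are absorbed
  into the weights of the form of \<open>B\<close>.\<close>

lemma Zsph_mult_psd_kernel:
  fixes n :: nat
  assumes \<phi>: "\<phi> \<in> Zsph N" and "psd_kernel B"
  shows "(\<Sum>j<n. \<Sum>k<n. B (u j) (u k) * \<phi> (- x j + x k) * c j * cnj (c k)) \<ge> 0"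
proof -
  let ?a = "\<lambda>j y. \<phi> (- x j + y)"
  have a: "continuous_on UNIV (?a j)" for j
    by (intro continuous_intros continuous_comp[OF Zsph_continuous[OF \<phi>]])
  have i: "integrable M (\<lambda>y. ?a j y * cnj (?a k y))" for j k
    by (intro integrable_ip a)
  have "0 \<le> (\<integral>y. (\<Sum>j<n. \<Sum>k<n. B (u j) (u k) * (c j * ?a j y) * cnj (c k * ?a k y)) \<partial>M)"
  proof (intro integral_complex_nonneg continuous_intros a)
    show "(\<Sum>j<n. \<Sum>k<n. B (u j) (u k) * (c j * ?a j y) * cnj (c k * ?a k y)) \<ge> 0" for y
      using assms(2)[unfolded psd_kernel_def, rule_format, where x = u and c = "\<lambda>j. c j * ?a j y"] .
  qed
  also have "\<dots> = (\<Sum>j<n. \<Sum>k<n. \<integral>y. B (u j) (u k) * c j * cnj (c k) * (?a j y * cnj (?a k y)) \<partial>M)"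
    using i by (simp add: mult_ac)
  also have "\<dots> = (\<Sum>j<n. \<Sum>k<n. sq \<phi> * (B (u j) (u k) * \<phi> (- x j + x k) * c j * cnj (c k)))"
    by (simp only: integral_mult_right_zero Zsph_reproducing[OF \<phi>] mult_ac)
  also have "\<dots> = sq \<phi> * (\<Sum>j<n. \<Sum>k<n. B (u j) (u k) * \<phi> (- x j + x k) * c j * cnj (c k))"
    by (simp only: sum_distrib_left)
  finally show ?thesis
    using sq_Zsph_pos[OF \<phi>] by (auto simp: less_eq_complex_def zero_le_mult_iff)
qed

end

section \<open>The dimension of the span of the translates as a trace\<close>

lemma function_vector_space: "vector_space (\<lambda>(c::complex) (h::'a \<Rightarrow> complex). \<lambda>x. c * h x)"
  by standard (auto simp: fun_eq_iff algebra_simps)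

text \<open>Finite dimension is a result here: Bessel's inequality for translates bounds the size of
  every orthonormal set in the span by \<open>1 / sq \<phi>\<close>, so a largest one exists, and it
  is a basis.\<close>

lemma (in compact_gelfand_pair) delta_Zsph:
  assumes \<phi>: "\<phi> \<in> Zsph N"
  shows "of_nat (delta \<phi>) * sq \<phi> = 1"
proof -
  interpret V: vector_space "\<lambda>(c::complex) (h::'g \<Rightarrow> complex). \<lambda>x. c * h x"
    by (rule function_vector_space)
  define L where "L g x = \<phi> (- g + x)" for g x
  define V where "V = V.span (range L)"
  define c where "c = sq \<phi>"
  have c: "c > 0" unfolding c_def by (rule sq_Zsph_pos[OF \<phi>])
  have L_cont: "continuous_on UNIV (L g)" for g
    unfolding L_def by (intro continuous_intros continuous_comp[OF Zsph_continuous[OF \<phi>]])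
  have L_rep: "ip (L g) (L x) = c * L g x" for g x
    using Zsph_reproducing[OF \<phi>] by (simp add: L_def c_def)
  \<comment> \<open>The continuous functions that satisfy the reproducing formula form a subspace
    containing all translates, hence their whole span.\<close>
  define R where "R = {v. continuous_on UNIV v \<and> (\<forall>x. ip v (L x) = complex_of_real c * v x)}"
  have "V.subspace R"
  proof (rule V.subspaceI)
    show "v + w \<in> R" if "v \<in> R" "w \<in> R" for v w
      using that integrable_ip[OF _ L_cont]
      by (auto simp: R_def plus_fun_def ring_distribs intro!: continuous_intros)
  qed (auto simp: R_def zero_fun_def mult.assoc intro!: continuous_intros)
  then have "V \<subseteq> R"
    unfolding V_def by (intro V.span_minimal) (auto simp: R_def L_cont L_rep)
  then have V_cont: "continuous_on UNIV v" and V_rep: "ip v (L x) = complex_of_real c * v x" if "v \<in> V" for v x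
    using that by (auto simp: R_def)
  have L_V: "L x \<in> V" for x
    unfolding V_def by (intro V.span_base) auto
  have V_sum: "(\<lambda>x. \<Sum>e\<in>E. a e * e x) \<in> V" if "E \<subseteq> V" for E a
  proof -
    have "(\<Sum>e\<in>E. (\<lambda>x. a e * e x)) \<in> V"
      using that unfolding V_def by (intro V.span_sum V.span_scale) auto
    moreover have "(\<Sum>e\<in>E. (\<lambda>x. a e * e x)) = (\<lambda>x. \<Sum>e\<in>E. a e * e x)"
      by (induction E rule: infinite_finite_induct) (auto simp: fun_eq_iff)
    ultimately show ?thesis by simp
  qed
  define ON where "ON E \<longleftrightarrow> finite E \<and> E \<subseteq> V \<and> (\<forall>e\<in>E. \<forall>e'\<in>E. ip e e' = (if e = e' then 1 else 0))" for E
  have proj: "ip (\<lambda>x. v x - (\<Sum>e\<in>E. ip v e * e x)) e' = 0" if E: "ON E" and v: "v \<in> V" and e': "e' \<in> E" for E v e'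
  proof -
    have "continuous_on UNIV e" if "e \<in> E" for e
      using that E V_cont by (auto simp: ON_def)
    then have "ip (\<lambda>x. v x - (\<Sum>e\<in>E. ip v e * e x)) e' = ip v e' - (\<Sum>e\<in>E. ip v e * ip e e')"
      using e' by (simp add: ip_diff_left ip_sum_left V_cont[OF v] continuous_intros)
    also have "(\<Sum>e\<in>E. ip v e * ip e e') = (\<Sum>e\<in>E. if e = e' then ip v e' else 0)"
      using E e' by (intro sum.cong) (auto simp: ON_def)
    finally show ?thesis using E e' by (simp add: ON_def)
  qed
  have ip_L: "ip (L x) e = complex_of_real c * cnj (e x)" if "e \<in> V" for e x
    using arg_cong[OF V_rep[OF that, of x], of cnj] by (simp add: ip_cnj del: integral_cnj)
  \<comment> \<open>Bessel's inequality for \<open>L x\<close>: its squared norm is \<open>c\<close>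
    because \<open>\<phi> 0 = 1\<close>, and its coefficients are \<open>c * cnj (e x)\<close>, so
    one factor \<open>c\<close> cancels.\<close>
  have bessel: "c * (\<Sum>e\<in>E. (cmod (e x))\<^sup>2) \<le> 1" if E: "ON E" for E x
  proof -
    have Ec: "continuous_on UNIV e" if "e \<in> E" for e
      using that E V_cont by (auto simp: ON_def)
    have EV: "E \<subseteq> V" using E by (simp add: ON_def)
    let ?h = "\<lambda>y. L x y - (\<Sum>e\<in>E. ip (L x) e * e y)"
    have hc: "continuous_on UNIV ?h"
      by (intro continuous_intros L_cont Ec)
    have "ip ?h (\<lambda>y. \<Sum>e\<in>E. ip (L x) e * e y) = (\<Sum>e\<in>E. cnj (ip (L x) e) * ip ?h e)"
      by (intro ip_sum_right hc Ec)
    then have h0: "ip ?h (\<lambda>y. \<Sum>e\<in>E. ip (L x) e * e y) = 0"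
      using proj[OF E L_V] by simp
    have "complex_of_real (sq ?h) = ip ?h ?h"
      by (intro ip_self[symmetric] hc)
    also have "\<dots> = ip ?h (L x) - ip ?h (\<lambda>y. \<Sum>e\<in>E. ip (L x) e * e y)"
      by (intro ip_diff_right hc L_cont continuous_intros Ec)
    also have "\<dots> = ip (L x) (L x) - ip (\<lambda>y. \<Sum>e\<in>E. ip (L x) e * e y) (L x)"
      unfolding h0 diff_zero by (intro ip_diff_left L_cont continuous_intros Ec)
    also have "ip (\<lambda>y. \<Sum>e\<in>E. ip (L x) e * e y) (L x) = (\<Sum>e\<in>E. ip (L x) e * ip e (L x))"
      by (intro ip_sum_left L_cont Ec)
    also have "\<dots> = (\<Sum>e\<in>E. c\<^sup>2 * (cmod (e x))\<^sup>2)"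
    proof -
      have "ip (L x) e * ip e (L x) = complex_of_real (c\<^sup>2 * (cmod (e x))\<^sup>2)" if "e \<in> E" for e
      proof -
        have "e \<in> V" using that EV by auto
        have "ip (L x) e * ip e (L x) = of_real (c\<^sup>2) * (e x * cnj (e x))"
          unfolding ip_L[OF \<open>e \<in> V\<close>] V_rep[OF \<open>e \<in> V\<close>] by (simp add: power2_eq_square)
        then show ?thesis
          by (simp only: complex_norm_square[symmetric] of_real_mult)
      qed
      then show ?thesis by simp
    qed
    also have "ip (L x) (L x) = c"
      by (simp only: L_rep) (simp add: L_def Zsph_0 \<phi>)
    finally have "sq ?h = c - (\<Sum>e\<in>E. c\<^sup>2 * (cmod (e x))\<^sup>2)"
      unfolding of_real_diff[symmetric] of_real_eq_iff .
    then have "(\<Sum>e\<in>E. c\<^sup>2 * (cmod (e x))\<^sup>2) \<le> c"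
      using sq_nonneg[of ?h] by linarith
    then have "c * (c * (\<Sum>e\<in>E. (cmod (e x))\<^sup>2)) \<le> c * 1"
      by (simp add: sum_distrib_left power2_eq_square mult.assoc)
    then show ?thesis using c by (simp only: mult_le_cancel_left_pos)
  qed
  have int_card: "(\<integral>x. c * (\<Sum>e\<in>E. (cmod (e x))\<^sup>2) \<partial>M) = c * card E" if E: "ON E" for E
  proof -
    have "sq e = 1" if "e \<in> E" for e
      using E that ip_self[OF V_cont, of e] by (auto simp: ON_def)
    moreover have "integrable M (\<lambda>x. (cmod (e x))\<^sup>2)" if "e \<in> E" for e
      using that E by (intro integrable_continuous continuous_intros V_cont) (auto simp: ON_def)
    ultimately show ?thesis by simp
  qed
  have card_le: "c * card E \<le> 1" if E: "ON E" for E
  proof -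
    have "continuous_on UNIV (\<lambda>x. c * (\<Sum>e\<in>E. (cmod (e x))\<^sup>2))"
      using E by (intro continuous_intros V_cont) (auto simp: ON_def)
    then have "(\<integral>x. c * (\<Sum>e\<in>E. (cmod (e x))\<^sup>2) \<partial>M) \<le> (\<integral>x. 1 \<partial>M)"
      using bessel[OF E] by (intro integral_mono integrable_continuous continuous_on_const)
    then show ?thesis by (simp only: int_card[OF E] integral_const)
  qed
  have "\<forall>E. ON E \<longrightarrow> card E < Suc (nat \<lfloor>1 / c\<rfloor>)"
    using card_le c by (auto simp: less_Suc_eq_le le_nat_floor field_simps)
  moreover have "ON {}" by (simp add: ON_def)
  ultimately have "\<exists>E. ON E \<and> (\<forall>E'. ON E' \<longrightarrow> card E' \<le> card E)"
    by (intro ex_has_greatest_nat[of ON "{}"])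
  then obtain E where E: "ON E" and E_max: "\<And>E'. ON E' \<Longrightarrow> card E' \<le> card E"
    by blast
  have fin: "finite E" and EV: "E \<subseteq> V" using E by (auto simp: ON_def)
  have Ec: "continuous_on UNIV e" if "e \<in> E" for e
    using that EV V_cont by auto
  \<comment> \<open>A nonzero remainder, normalised by \<open>t = 1 / sqrt (sq w)\<close>, would
    enlarge the maximal set \<open>E\<close>.\<close>
  have expand: "v = (\<lambda>x. \<Sum>e\<in>E. ip v e * e x)" if v: "v \<in> V" for v
  proof (rule ccontr)
    assume ne: "v \<noteq> (\<lambda>x. \<Sum>e\<in>E. ip v e * e x)"
    define w where "w = v - (\<lambda>x. \<Sum>e\<in>E. ip v e * e x)"
    have wV: "w \<in> V"
      using v V_sum[OF EV] unfolding w_def V_def by (intro V.span_diff)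
    have w_perp: "ip w e = 0" if "e \<in> E" for e
      using proj[OF E v that] by (simp add: w_def)
    have "w \<noteq> 0" using ne unfolding w_def right_minus_eq .
    then obtain x where "w x \<noteq> 0"
      unfolding fun_eq_iff zero_fun_apply by blast
    then have "sq w \<noteq> 0"
      using sq_eq_0_imp[OF V_cont[OF wV], of x] by blast
    then have sw: "sq w > 0" using sq_nonneg[of w] by linarith
    define t where "t = 1 / sqrt (sq w)"
    have t: "t * t * sq w = 1"
      using sw by (simp add: t_def)
    define e0 where "e0 = (\<lambda>x. complex_of_real t * w x)"
    have e0V: "e0 \<in> V"
      using wV unfolding e0_def V_def by (rule V.span_scale)
    have e0_perp: "ip e0 e = 0" if "e \<in> E" for e
      using w_perp[OF that] by (simp add: e0_def mult.assoc)
    then have e0_perp': "ip e e0 = 0" if "e \<in> E" for e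
      using that ip_cnj[of e0 e] by simp
    have "ip e0 e0 = (\<integral>x. of_real (t * t) * (w x * cnj (w x)) \<partial>M)"
      by (simp only: e0_def complex_cnj_mult complex_cnj_complex_of_real of_real_mult mult_ac)
    also have "\<dots> = of_real (t * t * sq w)"
      by (simp only: integral_mult_right_zero ip_self[OF V_cont[OF wV]] of_real_mult)
    finally have e0_1: "ip e0 e0 = 1" by (simp only: t of_real_1)
    then have notin: "e0 \<notin> E" using e0_perp by auto
    have "ON (insert e0 E)"
      using E e0V e0_1 e0_perp e0_perp' notin by (auto simp: ON_def)
    then show False
      using E_max[of "insert e0 E"] notin fin by simp
  qed
  \<comment> \<open>Evaluating the expansion of \<open>L x\<close> at \<open>x\<close> itself turns
    the Bessel bound into an equality; integrating it over \<open>x\<close> counts the elements of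
    \<open>E\<close>.\<close>
  have "c * (\<Sum>e\<in>E. (cmod (e x))\<^sup>2) = 1" for x
  proof -
    have "complex_of_real 1 = L x x" by (simp add: L_def Zsph_0 \<phi>)
    also have "\<dots> = (\<Sum>e\<in>E. ip (L x) e * e x)"
      by (rule fun_cong[OF expand[OF L_V]])
    also have "\<dots> = (\<Sum>e\<in>E. of_real c * of_real ((cmod (e x))\<^sup>2))"
      by (intro sum.cong refl, subst ip_L) (use EV in \<open>auto simp: complex_norm_square simp del: of_real_power\<close>)
    also have "\<dots> = of_real (c * (\<Sum>e\<in>E. (cmod (e x))\<^sup>2))"
      by (simp add: sum_distrib_left)
    finally show ?thesis unfolding of_real_eq_iff by simp
  qed
  then have trace: "c * card E = 1"
    using int_card[OF E] by (simp add: integral_const measure_UNIV space_UNIV)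
  have "V.span E = V.span (range L)"
  proof (rule V.span_eq[THEN iffD2], intro conjI)
    show "E \<subseteq> V.span (range L)" using EV by (simp add: V_def)
    show "range L \<subseteq> V.span E"
    proof clarify
      fix x
      have "(\<Sum>e\<in>E. (\<lambda>y. ip (L x) e * e y)) \<in> V.span E"
        by (intro V.span_sum V.span_scale V.span_base)
      also have "(\<Sum>e\<in>E. (\<lambda>y. ip (L x) e * e y)) = (\<lambda>y. \<Sum>e\<in>E. ip (L x) e * e y)"
        using fin by (induction E) (auto simp: fun_eq_iff)
      also have "\<dots> = L x" by (rule expand[OF L_V, symmetric])
      finally show "L x \<in> V.span E" .
    qed
  qed
  moreover have "V.independent E"
  proof (subst V.dependent_finite[OF fin], clarify)
    fix u e assume e: "e \<in> E" "u e \<noteq> 0" and 0: "(\<Sum>v\<in>E. (\<lambda>x. u v * v x)) = 0"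
    have "(\<Sum>v\<in>E. (\<lambda>x. u v * v x)) = (\<lambda>x. \<Sum>v\<in>E. u v * v x)"
      using fin by (induction E) (auto simp: fun_eq_iff)
    then have z: "(\<lambda>x. \<Sum>v\<in>E. u v * v x) = (\<lambda>x. 0)"
      using 0 by (simp add: zero_fun_def)
    have "0 = ip (\<lambda>x. \<Sum>v\<in>E. u v * v x) e"
      by (simp add: fun_cong[OF z])
    also have "\<dots> = (\<Sum>v\<in>E. u v * ip v e)"
      by (intro ip_sum_left Ec e(1))
    also have "\<dots> = (\<Sum>v\<in>E. if v = e then u e else 0)"
      using E e(1) by (intro sum.cong) (auto simp: ON_def)
    finally show False using e fin by simp
  qed
  ultimately have "V.dim (range L) = card E"
    by (intro V.dim_eq_card)
  moreover have "delta \<phi> = V.dim (range L)"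
    by (simp add: delta_def L_def[abs_def])
  ultimately show ?thesis
    using trace by (simp add: c_def mult.commute)
qed

section \<open>Idempotents of the convolution algebra\<close>

context compact_gelfand_pair
begin

section \<open>The commutative algebra of bi-invariant functions\<close>

definition alg :: "('g \<Rightarrow> complex) set" where
  "alg = {f. continuous_on UNIV f \<and> bi_invariant K f}"

lemma alg_continuous: "f \<in> alg \<Longrightarrow> continuous_on UNIV f"
  and alg_bi_invariant: "f \<in> alg \<Longrightarrow> bi_invariant K f"
  and algI: "continuous_on UNIV f \<Longrightarrow> bi_invariant K f \<Longrightarrow> f \<in> alg"
  by (simp_all add: alg_def)

lemma alg_scale: "f \<in> alg \<Longrightarrow> (\<lambda>x. c * f x) \<in> alg"
  and alg_add: "f \<in> alg \<Longrightarrow> g \<in> alg \<Longrightarrow> (\<lambda>x. f x + g x) \<in> alg"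
  and alg_diff: "f \<in> alg \<Longrightarrow> g \<in> alg \<Longrightarrow> (\<lambda>x. f x - g x) \<in> alg"
  by (simp_all add: alg_def bi_invariant_def continuous_on_mult continuous_on_add continuous_on_diff)

lemma alg_star:
  assumes "f \<in> alg"
  shows "star f \<in> alg"
proof (rule algI[OF continuous_star[OF alg_continuous[OF assms]] bi_invariantI])
  fix k x assume "k \<in> K"
  then show "star f (k + x) = star f x" and "star f (x + k) = star f x"
    unfolding star_def minus_add
    by (simp_all only: bi_invariantD[OF alg_bi_invariant[OF assms] K_uminus])
qed

lemma alg_convolution:
  assumes f: "f \<in> alg" and g: "g \<in> alg"
  shows "conv f g \<in> alg"
proof (rule algI[OF continuous_convolution[OF alg_continuous[OF f] alg_continuous[OF g]] bi_invariantI])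
  fix k x assume k: "k \<in> K"
  have c: "continuous_on UNIV (\<lambda>y. f y * g (- y + (k + x)))"
    by (intro continuous_intros continuous_comp[OF alg_continuous[OF g]] alg_continuous f)
  have "conv f g (k + x) = (\<integral>y. f (k + y) * g (- (k + y) + (k + x)) \<partial>M)"
    unfolding convolution_def by (rule integral_translate_left[OF c, symmetric])
  also have "\<dots> = conv f g x"
    using bi_invariantD(1)[OF alg_bi_invariant[OF f] k]
    by (simp add: convolution_def group_simps del: add_uminus_conv_diff)
  finally show "conv f g (k + x) = conv f g x" .
  show "conv f g (x + k) = conv f g x"
    using bi_invariantD(2)[OF alg_bi_invariant[OF g] k]
    by (simp add: convolution_def add.assoc[symmetric])
qed

lemma alg_uniform_limit:
  assumes "\<And>n. W n \<in> alg" and "uniform_limit UNIV W P sequentially"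
  shows "P \<in> alg"
proof (rule algI)
  show "continuous_on UNIV P"
    by (rule uniform_limit_theorem[OF _ assms(2)]) (use assms(1) alg_continuous in auto)
  have lim: "(\<lambda>n. W n x) \<longlonglongrightarrow> P x" for x
    by (rule tendsto_uniform_limitI[OF assms(2)]) simp
  show "bi_invariant K P"
  proof (rule bi_invariantI)
    fix k x assume k: "k \<in> K"
    show "P (k + x) = P x"
      using lim[of "k + x"] lim[of x] bi_invariantD(1)[OF alg_bi_invariant[OF assms(1)] k]
      by (simp add: LIMSEQ_unique)
    show "P (x + k) = P x"
      using lim[of "x + k"] lim[of x] bi_invariantD(2)[OF alg_bi_invariant[OF assms(1)] k]
      by (simp add: LIMSEQ_unique)
  qed
qed

lemma alg_assoc: "f \<in> alg \<Longrightarrow> g \<in> alg \<Longrightarrow> h \<in> alg \<Longrightarrow> conv (conv f g) h = conv f (conv g h)"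
  by (intro convolution_assoc alg_continuous)

lemma alg_commute: "f \<in> alg \<Longrightarrow> g \<in> alg \<Longrightarrow> conv f g = conv g f"
  by (intro convolution_commute alg_continuous alg_bi_invariant)

lemma alg_star_convolution: "f \<in> alg \<Longrightarrow> g \<in> alg \<Longrightarrow> star (conv f g) = conv (star f) (star g)"
  by (simp add: star_convolution alg_continuous alg_commute alg_star)

lemma star_star: "star (star f) = f"
  by (simp add: star_def)

lemma hermitian_convolution_0: "star g = g \<Longrightarrow> conv f g 0 = ip f g"
  using convolution_star_0[of f g] by simp

text \<open>Power iteration.  Writing \<open>s\<close> for the squared norms of the powers of \<open>T\<close>, the
  Cauchy--Schwarz inequality makes \<open>s\<close> log-convex, so the quotients \<open>s (n + 1) / s n\<close> increase to
  some \<open>l\<close>, and \<open>s\<close> is submultiplicative, so \<open>s n / l ^ (n + 1)\<close> decreases to a limit that is at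
  least 1.  This limit exists, hence the rescaled even powers of \<open>T\<close> are Cauchy in mean square;
  one more convolution turns this into uniform convergence.\<close>

lemma hermitian_idempotent_exists:
  assumes T: "T \<in> alg" and T_star: "star T = T" and "T x0 \<noteq> 0"
  obtains P :: "'g \<Rightarrow> complex" and l :: real
  where "P \<in> alg" and "star P = P" and "conv P P = P" and "P 0 \<noteq> 0" and "l > 0"
    and "conv (conv T T) P = (\<lambda>x. complex_of_real l * P x)"
    and "\<And>p. p \<in> alg \<Longrightarrow> conv T p = T \<Longrightarrow> conv P p = P"
proof -
  \<comment> \<open>Shifted indexing: \<open>pw n\<close> is the convolution power of order
    \<open>n + 1\<close>, since a unit need not exist. This is the source of the \<open>Suc\<close>
    in the index laws below.\<close>
  define pw where "pw n = (conv T ^^ n) T" for n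
  have pw_0: "pw 0 = T" and pw_Suc: "pw (Suc n) = conv T (pw n)" for n
    by (simp_all add: pw_def)
  have pw_alg: "pw n \<in> alg" for n
    by (induction n) (simp_all add: pw_0 pw_Suc T alg_convolution)
  note pw_cont = alg_continuous[OF pw_alg]
  have pw_star: "star (pw n) = pw n" for n
    by (induction n) (simp_all add: pw_0 pw_Suc T T_star alg_star_convolution pw_alg)
  have pw_conv: "conv (pw m) (pw n) = pw (Suc (m + n))" for m n
    by (induction m) (simp_all add: pw_0 pw_Suc alg_assoc T pw_alg)
  have pw_ip: "ip (pw m) (pw n) = pw (Suc (m + n)) 0" for m n
    using hermitian_convolution_0[OF pw_star, of "pw m" n] by (simp add: pw_conv)
  define s where "s n = sq (pw n)" for n
  have s_pw: "pw (Suc (n + n)) 0 = of_real (s n)" for n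
    using pw_ip[of n n] ip_self[OF pw_cont, of n] by (simp add: s_def)
  \<comment> \<open>Cauchy--Schwarz for \<open>pw n\<close> and \<open>pw (n + 2)\<close>: their
    inner product depends only on the sum of the indices, so it equals
    \<open>s (n + 1)\<close>.\<close>
  have s_convex: "(s (Suc n))\<^sup>2 \<le> s n * s (Suc (Suc n))" for n
    using cauchy_schwarz[OF pw_cont pw_cont, of n "Suc (Suc n)"] s_pw[of "Suc n"]
    by (simp add: pw_ip flip: s_def)
  have s_mult: "s (Suc (m + n)) \<le> s m * s n" for m n
    using sq_convolution_le[OF pw_cont pw_cont, of m n] by (simp add: pw_conv flip: s_def)
  have s_pos_iff: "s n > 0 \<longleftrightarrow> (\<exists>x. pw n x \<noteq> 0)" for n
  proof
    assume "s n > 0"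
    then show "\<exists>x. pw n x \<noteq> 0" by (rule contrapos_pp) (simp add: s_def)
  next
    assume "\<exists>x. pw n x \<noteq> 0"
    then have "s n \<noteq> 0" using sq_eq_0_imp[OF pw_cont] unfolding s_def by blast
    then show "s n > 0" using sq_nonneg[of "pw n"] by (simp add: s_def less_le)
  qed
  \<comment> \<open>Two consecutive terms are carried along, because log-convexity bounds the next
    term from below only through both.\<close>
  have "s n > 0 \<and> s (Suc n) > 0" for n
  proof (induction n)
    case 0
    have "s 0 > 0" using s_pos_iff[of 0] \<open>T x0 \<noteq> 0\<close> by (auto simp: pw_0)
    moreover have "pw (Suc 0) 0 \<noteq> 0" using s_pw[of 0] \<open>s 0 > 0\<close> by simp
    ultimately show ?case using s_pos_iff[of "Suc 0"] by blast
  next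
    case (Suc n)
    then have "0 < s n * s (Suc (Suc n))"
      using s_convex[of n] by (meson less_le_trans zero_less_power)
    then show ?case using Suc by (simp add: zero_less_mult_iff)
  qed
  then have s_pos: "s n > 0" for n by blast
  define r where "r n = s (Suc n) / s n" for n
  have r_pos: "r n > 0" for n by (simp add: r_def s_pos)
  have r_inc: "incseq r"
    using s_convex s_pos by (intro incseq_SucI) (simp add: r_def field_simps power2_eq_square)
  have "r n \<le> s 0" for n
    using s_mult[of n 0] s_pos[of n] by (simp add: r_def field_simps)
  then obtain l where r_lim: "r \<longlonglongrightarrow> l" and r_le: "r n \<le> l" for n
    using incseq_convergent[OF r_inc, of "s 0"] by metis
  have l: "l > 0" using r_pos[of 0] r_le[of 0] by linarith
  have s_shift: "(\<lambda>m. s (m + k) / s m) \<longlonglongrightarrow> l ^ k" for k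
  proof (induction k)
    case 0
    then show ?case using s_pos by (simp add: less_imp_neq[symmetric])
  next
    case (Suc k)
    have "(\<lambda>m. (s (m + k) / s m) * r (m + k)) \<longlonglongrightarrow> l ^ k * l"
      by (intro tendsto_mult Suc LIMSEQ_ignore_initial_segment r_lim)
    moreover have "(s (m + k) / s m) * r (m + k) = s (m + Suc k) / s m" for m
      using s_pos[of "m + k"] by (simp add: r_def)
    ultimately show ?case by (simp only: power_Suc2)
  qed
  define t where "t n = s n / l ^ Suc n" for n
  \<comment> \<open>The product of \<open>n + 1\<close> consecutive quotients tends to
    \<open>l ^ (n + 1)\<close>, and submultiplicativity bounds it by \<open>s n\<close>. This lower
    bound keeps the limit \<open>P\<close> away from zero.\<close>
  have t_ge: "t n \<ge> 1" for n
  proof -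
    have "s (m + Suc n) / s m \<le> s n" for m
      using s_mult[of m n] s_pos[of m] by (simp add: field_simps)
    then have "l ^ Suc n \<le> s n"
      using s_shift[of "Suc n"] by (intro LIMSEQ_le_const2) auto
    then show ?thesis using l by (simp add: t_def field_simps)
  qed
  have "decseq t"
  proof (rule decseq_SucI)
    fix n
    have "s (Suc n) \<le> l * s n"
      using r_le[of n] s_pos[of n] by (simp add: r_def field_simps)
    then have "s (Suc n) / l ^ Suc (Suc n) \<le> (l * s n) / l ^ Suc (Suc n)"
      using l by (intro divide_right_mono) auto
    then show "t (Suc n) \<le> t n" using l by (simp add: t_def)
  qed
  then obtain \<tau> where t_lim: "t \<longlonglongrightarrow> \<tau>"
    using decseq_convergent[of t 1] t_ge by metis
  have \<tau>: "\<tau> \<ge> 1"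
    using t_lim t_ge by (intro LIMSEQ_le_const) auto
  \<comment> \<open>These are the powers of order \<open>n + 1\<close> of \<open>T * T\<close>,
    divided by \<open>l ^ (n + 1)\<close>. Their values at \<open>0\<close> and all their inner
    products are terms of the convergent sequence \<open>t\<close>.\<close>
  define W where "W n = (\<lambda>x. complex_of_real (1 / l ^ Suc n) * pw (Suc (n + n)) x)" for n
  have W_alg: "W n \<in> alg" for n
    unfolding W_def by (intro alg_scale pw_alg)
  note W_cont = alg_continuous[OF W_alg]
  have W_0: "W n 0 = t n" for n
    by (simp add: W_def s_pw t_def)
  have W_star: "star (W n) = W n" for n
    using pw_star[of "Suc (n + n)"] by (simp add: W_def star_def fun_eq_iff)
  have W_conv: "conv (W m) (W n) = W (Suc (m + n))" for m n
  proof -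
    have "Suc (Suc (m + m) + Suc (n + n)) = Suc (Suc (m + n) + Suc (m + n))" by simp
    then show ?thesis
      unfolding W_def convolution_scale_left convolution_scale_right pw_conv
      by (simp only: power_Suc power_add of_real_mult of_real_divide of_real_1 times_divide_times_eq
          mult.assoc[symmetric] mult_1_right mult_1_left times_divide_eq_left times_divide_eq_right) (simp add: mult_ac)
  qed
  have W_ip: "ip (W m) (W n) = t (Suc (m + n))" for m n
    using hermitian_convolution_0[OF W_star, of "W m" n] by (simp add: W_conv W_0)
  have W_T: "conv (W n) (conv T T) = (\<lambda>x. complex_of_real l * W (Suc n) x)" for n
  proof -
    have "conv (pw (Suc (n + n))) (conv T T) = pw (Suc (Suc n + Suc n))"
      using pw_conv[of "Suc (n + n)" "Suc 0"] by (simp add: pw_0 pw_Suc)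
    then show ?thesis
      using l unfolding W_def convolution_scale_left by simp
  qed
  have W_diff: "sq (\<lambda>x. W m x - W n x) = t (Suc (m + m)) + t (Suc (n + n)) - 2 * t (Suc (m + n))" for m n
  proof -
    have "complex_of_real (sq (\<lambda>x. W m x - W n x)) = ip (\<lambda>x. W m x - W n x) (\<lambda>x. W m x - W n x)"
      by (intro ip_self[symmetric] continuous_intros W_cont)
    also have "\<dots> = (ip (W m) (W m) - ip (W m) (W n)) - (ip (W n) (W m) - ip (W n) (W n))"
      by (simp only: ip_diff_left[OF W_cont W_cont continuous_on_diff[OF W_cont W_cont]]
          ip_diff_right[OF W_cont W_cont W_cont])
    also have "\<dots> = of_real (t (Suc (m + m)) + t (Suc (n + n)) - 2 * t (Suc (m + n)))"
      unfolding W_ip by (simp add: add.commute)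
    finally show ?thesis unfolding of_real_eq_iff .
  qed
  have W_close: "(cmod (W (Suc m) x - W (Suc n) x))\<^sup>2 \<le> sq (\<lambda>x. W m x - W n x) * sq (conv T T) / l\<^sup>2" for m n x
  proof -
    have "complex_of_real l * W (Suc m) x - complex_of_real l * W (Suc n) x = conv (\<lambda>x. W m x - W n x) (conv T T) x"
      using fun_cong[OF W_T, of _ x]
      by (simp add: convolution_diff_left[OF W_cont W_cont] alg_continuous alg_convolution T)
    then have "(cmod (of_real l * (W (Suc m) x - W (Suc n) x)))\<^sup>2 \<le> sq (\<lambda>x. W m x - W n x) * sq (conv T T)"
      using norm_convolution_le[of "\<lambda>x. W m x - W n x" "conv T T" x]
      by (simp add: right_diff_distrib W_cont continuous_intros alg_continuous alg_convolution T)
    then have "l\<^sup>2 * (cmod (W (Suc m) x - W (Suc n) x))\<^sup>2 \<le> sq (\<lambda>x. W m x - W n x) * sq (conv T T)"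
      by (simp only: norm_mult norm_of_real power_mult_distrib power2_abs)
    then show ?thesis
      using l by (simp add: pos_le_divide_eq mult.commute)
  qed
  have "uniformly_Cauchy_on UNIV (\<lambda>n. W (Suc n))"
    unfolding uniformly_Cauchy_on_def
  proof (intro allI impI)
    fix e :: real assume e: "e > 0"
    \<comment> \<open>The three terms in \<open>W_diff\<close> deviate from their limits by less
      than \<open>d + d + 2 * d\<close>, whence the 4 in \<open>d\<close>. The summand 1 makes
      \<open>C\<close> positive at once.\<close>
    define C where "C = sq (conv T T) / l\<^sup>2 + 1"
    have C: "C > 0" using sq_nonneg[of "conv T T"] by (simp add: C_def add_nonneg_pos)
    define d where "d = e\<^sup>2 / (4 * C)"
    have d: "d > 0" using e C by (simp add: d_def)
    then obtain n0 where n0: "\<And>n. n \<ge> n0 \<Longrightarrow> \<bar>t n - \<tau>\<bar> < d"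
      using t_lim by (auto simp: LIMSEQ_def dist_real_def)
    have "dist (W (Suc m) x) (W (Suc n) x) < e" if "m \<ge> n0" "n \<ge> n0" for m n x
    proof -
      have "\<bar>t (Suc (m + m)) - \<tau>\<bar> < d" "\<bar>t (Suc (n + n)) - \<tau>\<bar> < d" "\<bar>t (Suc (m + n)) - \<tau>\<bar> < d"
        using that by (auto intro!: n0)
      then have "sq (\<lambda>x. W m x - W n x) < 4 * d"
        unfolding W_diff by linarith
      have "(cmod (W (Suc m) x - W (Suc n) x))\<^sup>2 \<le> sq (\<lambda>x. W m x - W n x) * (sq (conv T T) / l\<^sup>2)"
        using W_close[of m x n] by simp
      also have "\<dots> \<le> sq (\<lambda>x. W m x - W n x) * C"
        by (intro mult_left_mono sq_nonneg) (simp add: C_def)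
      also have "\<dots> < 4 * d * C"
        using \<open>sq (\<lambda>x. W m x - W n x) < 4 * d\<close> C by (rule mult_strict_right_mono)
      also have "\<dots> = e\<^sup>2" using C by (simp add: d_def)
      finally show ?thesis
        using e by (simp add: dist_norm power_less_imp_less_base)
    qed
    then show "\<exists>M. \<forall>x\<in>UNIV. \<forall>m\<ge>M. \<forall>n\<ge>M. dist (W (Suc m) x) (W (Suc n) x) < e"
      by blast
  qed
  then obtain P where lim: "uniform_limit UNIV (\<lambda>n. W (Suc n)) P sequentially"
    using Cauchy_uniformly_convergent uniformly_convergent_on_def by blast
  have lim_pt: "(\<lambda>n. W (Suc n) x) \<longlonglongrightarrow> P x" for x
    by (rule tendsto_uniform_limitI[OF lim]) simp
  have lim_shift: "(\<lambda>n. W (Suc n + k) x) \<longlonglongrightarrow> P x" for x k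
    using LIMSEQ_ignore_initial_segment[OF lim_pt, of k] by simp
  have P: "P \<in> alg"
    by (rule alg_uniform_limit[OF W_alg lim])
  have conv_lim: "(\<lambda>n. conv (W (Suc n)) h x) \<longlonglongrightarrow> conv P h x" if "h \<in> alg" for h x
    by (intro convolution_tendsto[OF W_cont lim] alg_continuous that)
  \<comment> \<open>\<open>conv (W m) (W n)\<close> depends only on \<open>m + n\<close>, so
    convolving the limit with a fixed member merely shifts the sequence. Letting that member tend to
    \<open>P\<close> as well gives idempotence.\<close>
  have P_W: "conv P (W (Suc m)) = P" for m
  proof
    fix x
    have "(\<lambda>n. W (Suc n + Suc (Suc m)) x) \<longlonglongrightarrow> conv P (W (Suc m)) x"
      using conv_lim[OF W_alg, of "Suc m" x] by (simp add: W_conv)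
    then show "conv P (W (Suc m)) x = P x"
      using lim_shift LIMSEQ_unique by blast
  qed
  show ?thesis
  proof (rule that[OF P])
    show "star P = P"
    proof
      fix x
      have "(\<lambda>n. star (W (Suc n)) x) \<longlonglongrightarrow> star P x"
        unfolding star_def by (intro tendsto_cnj lim_pt)
      then show "star P x = P x"
        using lim_pt LIMSEQ_unique unfolding W_star by blast
    qed
    show "conv P P = P"
    proof
      fix x
      have "conv (W (Suc n)) P = P" for n
        using alg_commute[OF P W_alg] P_W by simp
      then have "(\<lambda>n. P x) \<longlonglongrightarrow> conv P P x"
        using conv_lim[OF P, of x] by simp
      then show "conv P P x = P x"
        using LIMSEQ_unique tendsto_const by blast
    qed
    have "(\<lambda>n. complex_of_real (t (Suc n))) \<longlonglongrightarrow> \<tau>"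
      by (intro tendsto_of_real LIMSEQ_Suc t_lim)
    then have "P 0 = \<tau>"
      using lim_pt[of 0] LIMSEQ_unique unfolding W_0 by blast
    then show "P 0 \<noteq> 0" using \<tau> by auto
    show "l > 0" by (rule l)
    have "conv P (conv T T) = (\<lambda>x. l * P x)"
    proof
      fix x
      have "(\<lambda>n. complex_of_real l * W (Suc n + 1) x) \<longlonglongrightarrow> of_real l * P x"
        by (intro tendsto_mult tendsto_const lim_shift)
      then show "conv P (conv T T) x = l * P x"
        using conv_lim[of "conv T T" x] LIMSEQ_unique by (simp add: W_T alg_convolution T)
    qed
    then show "conv (conv T T) P = (\<lambda>x. l * P x)"
      using alg_commute[OF P, of "conv T T"] by (simp add: alg_convolution T)
    fix p assume p: "p \<in> alg" and "conv T p = T"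
    have "conv (pw n) p = pw n" for n
      by (induction n) (simp_all add: pw_0 pw_Suc \<open>conv T p = T\<close> alg_assoc T pw_alg p)
    then have "conv (W n) p = W n" for n
      by (simp only: W_def convolution_scale_left)
    then have "(\<lambda>n. W (Suc n) x) \<longlonglongrightarrow> conv P p x" for x
      using conv_lim[OF p, of x] by simp
    then show "conv P p = P"
      using lim_pt LIMSEQ_unique by blast
  qed
qed

section \<open>Hermitian idempotents and minimality\<close>

definition idempotent :: "('g \<Rightarrow> complex) \<Rightarrow> bool" where
  "idempotent q \<longleftrightarrow> q \<in> alg \<and> star q = q \<and> conv q q = q \<and> q 0 \<noteq> 0"

text \<open>Follows from \<open>q = q * star q\<close>. Thus the clause
  \<open>q 0 \<noteq> 0\<close> of the definition says that \<open>q\<close> is not the zero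
  function, and squared norms of idempotents can be subtracted by evaluating at
  \<open>0\<close>.\<close>

lemma idempotent_0: "idempotent q \<Longrightarrow> q 0 = of_real (sq q)"
  using hermitian_convolution_0[of q q] ip_self[of q] by (simp add: idempotent_def alg_continuous)

lemma idempotentI:
  assumes "q \<in> alg" and "star q = q" and "conv q q = q" and "q x \<noteq> 0"
  shows "idempotent q"
proof -
  have "sq q \<noteq> 0" using sq_eq_0_imp[OF alg_continuous] assms(1,4) by blast
  then have "q 0 \<noteq> 0"
    using hermitian_convolution_0[OF assms(2), of q] ip_self[OF alg_continuous[OF assms(1)]] assms(3) by simp
  then show ?thesis using assms by (simp add: idempotent_def)
qed

lemma sq_idempotent_ge_1:
  assumes "idempotent q"
  shows "sq q \<ge> 1"
proof -
  have q: "q \<in> alg" "conv q q = q" "q 0 \<noteq> 0" using assms by (auto simp: idempotent_def)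
  have "sq q \<le> sq q * sq q"
    using sq_convolution_le[OF alg_continuous alg_continuous, OF q(1) q(1)] by (simp add: q(2))
  moreover have "sq q > 0"
    using idempotent_0[OF assms] q(3) sq_nonneg[of q] by (simp add: less_le)
  ultimately show ?thesis by simp
qed

text \<open>Among the idempotents below \<open>P\<close>, one with the least integer part of the
  squared norm is minimal: for \<open>q\<close> properly below \<open>p\<close>, the difference
  \<open>p - q\<close> is again idempotent, so \<open>sq p - sq q \<ge> 1\<close>.\<close>

lemma minimal_idempotent_exists:
  assumes P: "idempotent P"
  obtains p where "idempotent p" and "conv p P = p"
    and "\<And>q. idempotent q \<Longrightarrow> conv q p = q \<Longrightarrow> q = p"
proof -
  define B where "B q \<longleftrightarrow> idempotent q \<and> conv q P = q" for q
  have "B P" using P by (simp add: B_def idempotent_def)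
  then obtain p where p: "B p" and min: "\<And>q. B q \<Longrightarrow> nat \<lfloor>sq p\<rfloor> \<le> nat \<lfloor>sq q\<rfloor>"
    using ex_has_least_nat[of B P "\<lambda>q. nat \<lfloor>sq q\<rfloor>"] by blast
  have p_alg: "p \<in> alg" "star p = p" "conv p p = p" and pI: "idempotent p" and P_alg: "P \<in> alg"
    using p P by (auto simp: B_def idempotent_def)
  show ?thesis
  proof (rule that[OF pI])
    show "conv p P = p" using p by (simp add: B_def)
    fix q assume q: "idempotent q" and qp: "conv q p = q"
    have q_alg: "q \<in> alg" "star q = q" "conv q q = q" using q by (auto simp: idempotent_def)
    have "conv q P = conv (conv q p) P" by (simp add: qp)
    also have "\<dots> = conv q (conv p P)" by (rule alg_assoc[OF q_alg(1) p_alg(1) P_alg])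
    also have "\<dots> = q" using p by (simp add: B_def qp)
    finally have "B q" using q by (simp add: B_def)
    show "q = p"
    proof (rule ccontr)
      assume "q \<noteq> p"
      then obtain x where x: "p x - q x \<noteq> 0" by (metis ext right_minus_eq)
      let ?d = "\<lambda>x. p x - q x"
      have d_alg: "?d \<in> alg" by (intro alg_diff p_alg q_alg)
      have pq: "conv p q = q" using alg_commute[OF p_alg(1) q_alg(1)] qp by simp
      have d_right: "conv ?d h = (\<lambda>x. conv p h x - conv q h x)" if "h \<in> alg" for h
        by (intro convolution_diff_left alg_continuous p_alg q_alg that)
      have "conv ?d ?d = (\<lambda>x. conv ?d p x - conv ?d q x)"
        unfolding alg_commute[OF d_alg p_alg(1)] alg_commute[OF d_alg q_alg(1)]
        by (rule d_right[OF d_alg])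
      also have "\<dots> = ?d"
        by (simp add: d_right p_alg q_alg qp pq)
      finally have "conv ?d ?d = ?d" .
      moreover have "star ?d = ?d"
        using p_alg(2) q_alg(2) by (simp add: star_def fun_eq_iff)
      ultimately have d: "idempotent ?d"
        using d_alg x by (intro idempotentI)
      have "complex_of_real (sq ?d) = of_real (sq p - sq q)"
        using idempotent_0[OF d] idempotent_0[OF pI] idempotent_0[OF q] by simp
      then have "sq p - sq q \<ge> 1"
        using sq_idempotent_ge_1[OF d] unfolding of_real_eq_iff by simp
      then have "nat \<lfloor>sq q\<rfloor> < nat \<lfloor>sq p\<rfloor>"
        using sq_nonneg[of q] by linarith
      then show False using min[OF \<open>B q\<close>] by linarith
    qed
  qed
qed

end

section \<open>Completeness of the spherical functions\<close>

context compact_gelfand_pair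
begin

text \<open>Below \<open>p\<close>, every nonzero hermitian element squares to a positive multiple
  of \<open>p\<close>, because the idempotent produced by power iteration lies below
  \<open>p\<close>. So \<open>h * h = l * p\<close>, and \<open>h - c * p\<close> and
  \<open>h + c * p\<close> annihilate each other for \<open>c = sqrt l\<close>. If the first factor
  is nonzero, its own square is a positive multiple of \<open>p\<close>, and multiplying by it once
  more kills the second.\<close>

lemma minimal_idempotent_hermitian:
  assumes p: "idempotent p" and min: "\<And>q. idempotent q \<Longrightarrow> conv q p = q \<Longrightarrow> q = p"
    and h: "h \<in> alg" "star h = h" "conv h p = h"
  shows "\<exists>a. h = (\<lambda>x. a * p x)"
proof -
  have p_alg: "p \<in> alg" "star p = p" using p by (auto simp: idempotent_def)
  have square: "\<exists>l>0. conv a a = (\<lambda>x. complex_of_real l * p x)"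
    if a: "a \<in> alg" "star a = a" "conv a p = a" and "a x \<noteq> 0" for a x
  proof -
    obtain q and l :: real where q: "q \<in> alg" "star q = q" "conv q q = q" "q 0 \<noteq> 0" and l: "l > 0"
        and eig: "conv (conv a a) q = (\<lambda>x. complex_of_real l * q x)"
        and below: "\<And>p. p \<in> alg \<Longrightarrow> conv a p = a \<Longrightarrow> conv q p = q"
      by (rule hermitian_idempotent_exists[OF a(1,2) \<open>a x \<noteq> 0\<close>]) (rule that)
    have "q = p"
      using min below[OF p_alg(1) a(3)] q by (simp add: idempotent_def)
    moreover have "conv (conv a a) p = conv a a"
      by (simp only: alg_assoc[OF a(1) a(1) p_alg(1)] a(3))
    ultimately show ?thesis using eig l by auto
  qed
  show ?thesis
  proof (cases "\<exists>x. h x \<noteq> 0")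
    case False
    then have "h = (\<lambda>x. 0 * p x)" by auto
    then show ?thesis by blast
  next
    case True
    then obtain l where l: "l > 0" and hh: "conv h h = (\<lambda>x. complex_of_real l * p x)"
      using square[OF h] by blast
    define c where "c = complex_of_real (sqrt l)"
    have c2: "c * c = of_real l" using l by (simp add: c_def flip: of_real_mult)
    have ph: "conv p h = h" using alg_commute[OF p_alg(1) h(1)] h(3) by simp
    have pp: "conv p p = p" using p by (simp add: idempotent_def)
    let ?a = "\<lambda>x. h x - c * p x" and ?b = "\<lambda>x. h x + c * p x"
    have cp: "(\<lambda>x. c * p x) \<in> alg" by (intro alg_scale p_alg)
    have a: "?a \<in> alg" and b: "?b \<in> alg" by (intro alg_diff alg_add h cp)+
    have a_left: "conv ?a g = (\<lambda>x. conv h g x - c * conv p g x)" if "g \<in> alg" for g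
      using convolution_diff_left[OF alg_continuous[OF h(1)] alg_continuous[OF cp] alg_continuous[OF that]]
      by (simp add: convolution_scale_left)
    have b_left: "conv ?b g = (\<lambda>x. conv h g x + c * conv p g x)" if "g \<in> alg" for g
      using convolution_add_left[OF alg_continuous[OF h(1)] alg_continuous[OF cp] alg_continuous[OF that]]
      by (simp add: convolution_scale_left)
    have ap: "conv ?a p = ?a"
      by (simp add: a_left p_alg h(3) pp)
    show ?thesis
    proof (cases "\<exists>x. ?a x \<noteq> 0")
      case False
      then show ?thesis by (intro exI[of _ c]) (auto simp: fun_eq_iff)
    next
      case True
      moreover have "star ?a = ?a"
        using fun_cong[OF h(2)] fun_cong[OF p_alg(2)] by (simp add: star_def c_def fun_eq_iff)
      ultimately obtain m where m: "m > 0" and aa: "conv ?a ?a = (\<lambda>x. complex_of_real m * p x)"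
        using square[OF a _ ap] by blast
      have "conv ?a ?b = (\<lambda>x. 0)"
        by (simp add: a_left[OF b] alg_commute[OF h(1) b] alg_commute[OF p_alg(1) b]
            b_left h(1) p_alg(1) hh ph h(3) pp ring_distribs c2[symmetric] mult.assoc)
      then have "(\<lambda>x. 0) = conv ?a (conv ?a ?b)"
        by (simp add: convolution_def fun_eq_iff)
      also have "\<dots> = conv (\<lambda>x. complex_of_real m * p x) ?b"
        by (simp only: alg_assoc[OF a a b, symmetric] aa)
      also have "\<dots> = (\<lambda>x. of_real m * ?b x)"
        by (simp add: convolution_scale_left alg_commute[OF p_alg(1) b] b_left p_alg(1) h(3) pp)
      finally have "?b x = 0" for x
        using m by (simp add: fun_eq_iff)
      then have "h = (\<lambda>x. (- c) * p x)"
        by (auto simp: add_eq_0_iff2)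
      then show ?thesis by blast
    qed
  qed
qed

text \<open>\<open>conv h p\<close> is split into hermitian parts \<open>?h1 + \<i> * ?h2\<close>;
  both stay below \<open>p\<close> because \<open>star\<close> is multiplicative on the commutative
  algebra.\<close>

lemma minimal_idempotent_scalar:
  assumes p: "idempotent p" and min: "\<And>q. idempotent q \<Longrightarrow> conv q p = q \<Longrightarrow> q = p"
    and h: "h \<in> alg"
  shows "\<exists>a. conv h p = (\<lambda>x. a * p x)"
proof -
  have p_alg: "p \<in> alg" "star p = p" "conv p p = p" using p by (auto simp: idempotent_def)
  define g where "g = conv h p"
  have g: "g \<in> alg" unfolding g_def by (intro alg_convolution h p_alg)
  have gp: "conv g p = g"
    by (simp add: g_def alg_assoc h p_alg)
  have sgp: "conv (star g) p = star g"
    using alg_star_convolution[OF g p_alg(1)] by (simp add: gp p_alg(2))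
  have cg: "continuous_on UNIV g" "continuous_on UNIV (star g)" "continuous_on UNIV p"
    by (intro alg_continuous alg_star g p_alg)+
  let ?h1 = "\<lambda>x. 1 / 2 * (g x + star g x)" and ?h2 = "\<lambda>x. - \<i> / 2 * (g x - star g x)"
  have "\<exists>a. ?h1 = (\<lambda>x. a * p x)"
  proof (rule minimal_idempotent_hermitian[OF p min])
    show "?h1 \<in> alg" by (intro alg_scale alg_add alg_star g)
    show "star ?h1 = ?h1" by (simp add: star_def fun_eq_iff add.commute)
    show "conv ?h1 p = ?h1"
      unfolding convolution_scale_left convolution_add_left[OF cg] gp sgp ..
  qed
  moreover have "\<exists>a. ?h2 = (\<lambda>x. a * p x)"
  proof (rule minimal_idempotent_hermitian[OF p min])
    show "?h2 \<in> alg" by (intro alg_scale alg_diff alg_star g)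
    show "star ?h2 = ?h2" by (simp add: star_def fun_eq_iff algebra_simps)
    show "conv ?h2 p = ?h2"
      unfolding convolution_scale_left convolution_diff_left[OF cg] gp sgp ..
  qed
  ultimately obtain a b where ab: "?h1 = (\<lambda>x. a * p x)" "?h2 = (\<lambda>x. b * p x)" by blast
  have "g x = (a + \<i> * b) * p x" for x
  proof -
    have "g x = ?h1 x + \<i> * ?h2 x" by (simp add: algebra_simps)
    also have "\<dots> = a * p x + \<i> * (b * p x)"
      using fun_cong[OF ab(1), of x] fun_cong[OF ab(2), of x] by simp
    finally show ?thesis by (simp add: algebra_simps)
  qed
  then show ?thesis unfolding g_def by blast
qed

text \<open>Since \<open>p = p * star p\<close>, the kernel \<open>p (- a + b)\<close> is the Gram
  kernel of the translates of \<open>p\<close>.\<close>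

lemma idempotent_pos_def:
  assumes p: "idempotent p"
  shows "pos_def p"
proof -
  have p_alg: "p \<in> alg" "star p = p" "conv p p = p" using p by (auto simp: idempotent_def)
  note c = alg_continuous[OF p_alg(1)]
  define Q where "Q a b = (\<integral>y. p (- a + y) * cnj (p (- b + y)) \<partial>M)" for a b
  have split: "p (- a + b) = Q a b" for a b
  proof -
    have "p (- a + b) = (\<integral>y. p y * p (- y + (- a + b)) \<partial>M)"
      using fun_cong[OF p_alg(3), of "- a + b"] by (simp add: convolution_def)
    also have "\<dots> = (\<integral>y. p (- a + y) * p (- (- a + y) + (- a + b)) \<partial>M)"
      by (intro integral_translate_left[symmetric, of "\<lambda>y. p y * p (- y + (- a + b))"]
          continuous_intros c continuous_comp[OF c])
    also have "\<dots> = (\<integral>y. p (- a + y) * cnj (p (- b + y)) \<partial>M)"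
    proof -
      have "p (- (- a + y) + (- a + b)) = cnj (p (- b + y))" for y
        using fun_cong[OF p_alg(2), of "- y + b"]
        by (simp add: star_def group_simps del: add_uminus_conv_diff)
      then show ?thesis by (simp only:)
    qed
    finally show ?thesis by (simp only: Q_def)
  qed
  show ?thesis
    unfolding pos_def_def
  proof (intro conjI allI c)
    fix n :: nat and x :: "nat \<Rightarrow> 'g" and d :: "nat \<Rightarrow> complex"
    let ?S = "\<lambda>y. \<Sum>j<n. d j * p (- x j + y)"
    have i: "integrable M (\<lambda>y. p (- x j + y) * cnj (p (- x k + y)))" for j k
      by (intro integrable_continuous continuous_intros continuous_comp[OF c])
    have Sc: "continuous_on UNIV ?S"
      by (intro continuous_intros continuous_comp[OF c])
    have "(\<Sum>j<n. \<Sum>k<n. p (- x j + x k) * d j * cnj (d k)) = (\<Sum>j<n. \<Sum>k<n. Q (x j) (x k) * d j * cnj (d k))"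
      by (simp only: split)
    also have "\<dots> = (\<integral>y. (\<Sum>j<n. \<Sum>k<n. (p (- x j + y) * cnj (p (- x k + y))) * d j * cnj (d k)) \<partial>M)"
      using i by (simp add: Q_def)
    also have "\<dots> = (\<integral>y. ?S y * cnj (?S y) \<partial>M)"
      by (simp add: sum_product mult_ac)
    also have "\<dots> = of_real (sq ?S)"
      by (rule ip_self[OF Sc])
    finally show "0 \<le> (\<Sum>j<n. \<Sum>k<n. p (- x j + x k) * d j * cnj (d k))"
      using sq_nonneg[of ?S] by (simp add: less_eq_complex_def)
  qed
qed

text \<open>For fixed \<open>x\<close>, the defect of the functional equation of a spherical function is a
  bi-invariant function of \<open>y\<close> that is orthogonal to every bi-invariant function.\<close>

lemma minimal_idempotent_spherical:
  assumes p: "idempotent p" and min: "\<And>q. idempotent q \<Longrightarrow> conv q p = q \<Longrightarrow> q = p"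
  shows "(\<lambda>x. p x / p 0) \<in> Zsph N"
proof -
  have p_alg: "p \<in> alg" "p 0 \<noteq> 0" using p by (auto simp: idempotent_def)
  define \<phi> where "\<phi> = (\<lambda>x. inverse (p 0) * p x)"
  have \<phi>: "\<phi> \<in> alg" unfolding \<phi>_def by (intro alg_scale p_alg)
  note c = alg_continuous[OF \<phi>]
  have \<phi>_0: "\<phi> 0 = 1" using p_alg by (simp add: \<phi>_def)
  have "pos_def p" by (rule idempotent_pos_def[OF p])
  have "pos_def \<phi>"
    unfolding pos_def_def
  proof (intro conjI allI c)
    fix n :: nat and x :: "nat \<Rightarrow> 'g" and d :: "nat \<Rightarrow> complex"
    have "inverse (p 0) \<ge> 0"
      using idempotent_0[OF p] sq_nonneg[of p] by (simp add: less_eq_complex_def flip: of_real_inverse)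
    then have "0 \<le> inverse (p 0) * (\<Sum>j<n. \<Sum>k<n. p (- x j + x k) * d j * cnj (d k))"
      using \<open>pos_def p\<close> unfolding pos_def_def by (intro mult_nonneg_nonneg) blast+
    then show "0 \<le> (\<Sum>j<n. \<Sum>k<n. \<phi> (- x j + x k) * d j * cnj (d k))"
      by (simp add: \<phi>_def sum_distrib_left mult.assoc)
  qed
  have scalar: "\<exists>a. conv h \<phi> = (\<lambda>x. a * \<phi> x)" if "h \<in> alg" for h
  proof -
    obtain a where "conv h p = (\<lambda>x. a * p x)"
      using minimal_idempotent_scalar[OF p min \<open>h \<in> alg\<close>] by blast
    then have "conv h \<phi> = (\<lambda>x. a * \<phi> x)"
      by (simp add: \<phi>_def convolution_scale_right mult.left_commute)
    then show ?thesis by blast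
  qed
  have "(\<integral>k. \<phi> (y + k + x) \<partial>N) = \<phi> y * \<phi> x" for x y
  proof -
    \<comment> \<open>The argument is \<open>- y\<close> so that integrating either part of the
      defect against a function of \<open>y\<close> produces values of its convolution with
      \<open>\<phi>\<close>.\<close>
    define D where "D y = (\<integral>k. \<phi> (- y + (k + x)) \<partial>N) - \<phi> (- y) * \<phi> x" for y
    have cont: "continuous_on UNIV (\<lambda>(y, k). \<phi> (- y + (k + x)))"
      unfolding split_beta by (intro continuous_intros continuous_comp[OF c])
    have c1: "continuous_on UNIV (\<lambda>y. \<integral>k. \<phi> (- y + (k + x)) \<partial>N)"
      by (rule N.continuous_on_integral[OF cont])
    have c2: "continuous_on UNIV (\<lambda>y. \<phi> (- y))"
      by (intro continuous_intros continuous_comp[OF c])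
    have D_cont: "continuous_on UNIV D"
      unfolding D_def by (intro continuous_intros c1 c2)
    \<comment> \<open>Choosing the conjugate of the defect as the test function makes its
      orthogonality to \<open>D\<close> say \<open>sq D = 0\<close>.\<close>
    define h where "h y = cnj (D y)" for y
    have h: "h \<in> alg"
    proof (rule algI[OF _ bi_invariantI])
      show "continuous_on UNIV h" unfolding h_def by (intro continuous_intros D_cont)
      fix l z assume l: "l \<in> K"
      have inv: "\<phi> (- l + w) = \<phi> w" "\<phi> (w + - l) = \<phi> w" for w
        by (rule bi_invariantD[OF alg_bi_invariant[OF \<phi>] K_uminus[OF l]])+
      show "h (z + l) = h z"
        by (simp add: h_def D_def minus_add add.assoc inv del: add_uminus_conv_diff)
      have "continuous_on UNIV (\<lambda>k. \<phi> (- z + (k + x)))"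
        by (intro continuous_intros continuous_comp[OF c])
      from N_invariant[OF this K_uminus[OF l]]
      have "(\<integral>k. \<phi> (- z + (- l + (k + x))) \<partial>N) = (\<integral>k. \<phi> (- z + (k + x)) \<partial>N)"
        by (simp only: add.assoc)
      then show "h (l + z) = h z"
        by (simp add: h_def D_def minus_add add.assoc inv del: add_uminus_conv_diff)
    qed
    note hc = alg_continuous[OF h]
    obtain a where a: "conv h \<phi> = (\<lambda>x. a * \<phi> x)" using scalar[OF h] by blast
    have "(\<integral>y. h y * (\<integral>k. \<phi> (- y + (k + x)) \<partial>N) \<partial>M) = (\<integral>y. \<integral>k. h y * \<phi> (- y + (k + x)) \<partial>N \<partial>M)"
      by simp
    also have "\<dots> = (\<integral>k. \<integral>y. h y * \<phi> (- y + (k + x)) \<partial>M \<partial>N)"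
      by (intro integral_swap compact_borel_prob_axioms prob_N, unfold split_beta,
          intro continuous_intros continuous_comp[OF c] continuous_comp[OF hc])
    also have "\<dots> = (\<integral>k. a * \<phi> (k + x) \<partial>N)"
      using a by (simp add: convolution_def fun_eq_iff)
    also have "\<dots> = (\<integral>k. a * \<phi> x \<partial>N)"
    proof (rule integral_cong_AE)
      show "AE k in N. a * \<phi> (k + x) = a * \<phi> x"
        using N_supported
        by eventually_elim (simp add: bi_invariantD(1)[OF alg_bi_invariant[OF \<phi>]])
    qed (intro N.borel_measurable_continuous continuous_intros continuous_comp[OF c])+
    also have "\<dots> = a * \<phi> x" by (rule N.integral_const)
    finally have 1: "(\<integral>y. h y * (\<integral>k. \<phi> (- y + (k + x)) \<partial>N) \<partial>M) = a * \<phi> x" .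
    have 2: "(\<integral>y. h y * (\<phi> (- y) * \<phi> x) \<partial>M) = a * \<phi> x"
      using fun_cong[OF a, of 0] by (simp add: convolution_def \<phi>_0 flip: mult.assoc)
    have "complex_of_real (sq D) = (\<integral>y. h y * D y \<partial>M)"
      by (simp add: ip_self[OF D_cont, symmetric] h_def mult.commute)
    also have "\<dots> = (\<integral>y. h y * (\<integral>k. \<phi> (- y + (k + x)) \<partial>N) - h y * (\<phi> (- y) * \<phi> x) \<partial>M)"
      by (simp add: D_def right_diff_distrib)
    also have "\<dots> = 0"
      by (subst Bochner_Integration.integral_diff)
        (simp_all add: 1 2 integrable_continuous continuous_on_mult c1 c2 hc)
    finally have "sq D = 0" by simp
    then have "D (- y) = 0" by (rule sq_eq_0_imp[OF D_cont])
    then show ?thesis by (simp add: D_def add.assoc)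
  qed
  then have "\<phi> \<in> Zsph N"
    using c \<phi>_0 \<open>pos_def \<phi>\<close> by (simp add: Zsph_def spherical_def)
  then show ?thesis by (simp add: \<phi>_def divide_inverse mult.commute)
qed

theorem Zsph_complete:
  assumes R: "R \<in> alg" and orth: "\<And>\<phi>. \<phi> \<in> Zsph N \<Longrightarrow> ip R \<phi> = 0"
  shows "R x = 0"
proof (rule ccontr)
  assume "R x \<noteq> 0"
  define T where "T = conv R (star R)"
  have T: "T \<in> alg" unfolding T_def by (intro alg_convolution alg_star R)
  have "star T = T"
    by (simp add: T_def star_convolution star_star continuous_star alg_continuous R)
  moreover have "sq R \<noteq> 0"
    using sq_eq_0_imp[OF alg_continuous[OF R]] \<open>R x \<noteq> 0\<close> by blast
  then have "T 0 \<noteq> 0"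
    by (simp add: T_def convolution_star_0 ip_self[OF alg_continuous[OF R]])
  ultimately obtain P and l :: real where P: "P \<in> alg" "star P = P" "conv P P = P" "P 0 \<noteq> 0" and l: "l > 0"
      and eig: "conv (conv T T) P = (\<lambda>x. complex_of_real l * P x)"
    by (rule hermitian_idempotent_exists[OF T]) (rule that)
  obtain p where p: "idempotent p" and pP: "conv p P = p"
      and min: "\<And>q. idempotent q \<Longrightarrow> conv q p = q \<Longrightarrow> q = p"
    by (rule minimal_idempotent_exists[of P]) (use P in \<open>simp add: idempotent_def\<close>, rule that)
  have p_alg: "p \<in> alg" "p 0 \<noteq> 0" using p by (auto simp: idempotent_def)
  have Pp: "conv P p = p" using alg_commute[OF P(1) p_alg(1)] pP by simp
  define \<phi> where "\<phi> = (\<lambda>x. p x / p 0)"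
  have \<phi>: "\<phi> \<in> Zsph N"
    unfolding \<phi>_def by (rule minimal_idempotent_spherical[OF p min])
  \<comment> \<open>Orthogonality gives \<open>conv R \<phi> = 0\<close> by the eigenfunction
    identity, and \<open>p\<close> is a multiple of \<open>\<phi>\<close>, so \<open>T\<close>
    annihilates \<open>p\<close>. But \<open>p\<close> lies below \<open>P\<close>, on which
    \<open>T * T\<close> acts as the positive scalar \<open>l\<close>.\<close>
  have "conv R \<phi> = (\<lambda>x. 0)"
    by (simp add: convolution_Zsph[OF \<phi> alg_continuous[OF R] alg_bi_invariant[OF R]] orth[OF \<phi>])
  moreover have "p = (\<lambda>x. p 0 * \<phi> x)" using p_alg by (simp add: \<phi>_def)
  ultimately have "conv R p = (\<lambda>x. 0)"
    using convolution_scale_right[of R "p 0" \<phi>] by simp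
  moreover have "conv T p = conv (star R) (conv R p)"
    by (simp add: T_def alg_commute[OF R alg_star[OF R]] alg_assoc alg_star R p_alg)
  ultimately have Tp: "conv T p = (\<lambda>x. 0)"
    by (simp add: convolution_def fun_eq_iff)
  have "(\<lambda>x. complex_of_real l * p x) = conv (\<lambda>x. complex_of_real l * P x) p"
    by (simp add: convolution_scale_left Pp)
  also have "\<dots> = conv (conv T T) (conv P p)"
    by (simp only: eig[symmetric] alg_assoc alg_convolution T P(1) p_alg(1))
  also have "\<dots> = (\<lambda>x. 0)"
    by (simp add: Pp alg_assoc T p_alg Tp convolution_def fun_eq_iff)
  finally have "complex_of_real l * p 0 = 0" by (rule fun_cong)
  then show False using l p_alg by simp
qed

end

section \<open>Bessel's inequality and uniform expansions\<close>

text \<open>The form is enlarged by the point \<open>o1\<close>, carrying the total weight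
  \<open>C\<close>, while the other weights are multiplied by \<open>q\<close>. Integrated in
  \<open>y\<close> and \<open>z\<close> over a probability measure, the new kernel expresses
  positivity of \<open>H\<close> for the unit mass at \<open>o1\<close> plus the density
  \<open>q\<close>.\<close>

lemma psd_kernel_extra_point:
  fixes q :: "'a \<Rightarrow> complex"
  assumes "psd_kernel H"
  shows "psd_kernel (\<lambda>y z. H o1 o1 + H o1 z * cnj (q z) + q y * H y o1 + q y * cnj (q z) * H y z)"
  unfolding psd_kernel_def
proof (intro allI)
  fix n :: nat and x :: "nat \<Rightarrow> 'a" and c :: "nat \<Rightarrow> complex"
  define C where "C = (\<Sum>j<n. c j)"
  define d where "d j = q (x j) * c j" for j
  have "0 \<le> (\<Sum>j<Suc n. \<Sum>k<Suc n. H (if j < n then x j else o1) (if k < n then x k else o1) *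
      (if j < n then d j else C) * cnj (if k < n then d k else C))"
    using assms unfolding psd_kernel_def
    by (elim allE[of _ "Suc n"] allE[of _ "\<lambda>j. if j < n then x j else o1"] allE[of _ "\<lambda>j. if j < n then d j else C"])
  also have "\<dots> = (\<Sum>j<n. \<Sum>k<n. H (x j) (x k) * d j * cnj (d k)) + (\<Sum>j<n. H (x j) o1 * d j) * cnj C
      + (C * (\<Sum>k<n. H o1 (x k) * cnj (d k)) + H o1 o1 * (C * cnj C))"
    by (simp add: sum.distrib sum_distrib_left sum_distrib_right mult_ac cong: sum.cong_simp)
  also have "\<dots> = (\<Sum>j<n. \<Sum>k<n. (H o1 o1 + H o1 (x k) * cnj (q (x k)) + q (x j) * H (x j) o1 +
      q (x j) * cnj (q (x k)) * H (x j) (x k)) * c j * cnj (c k))"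
    unfolding C_def cnj_sum sum_product by (simp add: d_def sum.distrib sum_distrib_left ring_distribs mult_ac)
  finally show "0 \<le> \<dots>" .
qed

text \<open>\<open>F0\<close> is chosen from the majorant alone, before \<open>a\<close> is known;
  this is where uniformity in \<open>(x, u)\<close> comes from.\<close>

lemma has_sum_tail_uniform:
  fixes M :: "'i \<Rightarrow> real"
  assumes "M summable_on Z" and "e > 0"
  obtains F0 where "finite F0" and "F0 \<subseteq> Z"
    and "\<And>F a s. finite F \<Longrightarrow> F0 \<subseteq> F \<Longrightarrow> F \<subseteq> Z \<Longrightarrow> \<forall>i\<in>Z. norm (a i :: complex) \<le> M i \<Longrightarrow>
          (a has_sum s) Z \<Longrightarrow> norm (s - sum a F) < e"
proof -
  obtain m where m: "(M has_sum m) Z" using assms(1) by (auto simp: summable_on_def)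
  obtain F0 where F0: "finite F0" "F0 \<subseteq> Z" "dist (sum M F0) m \<le> e / 2"
    using has_sum_finite_approximation[OF m, of "e / 2"] assms(2) by auto
  show ?thesis
  proof (rule that[OF F0(1,2)])
    fix F and a :: "'i \<Rightarrow> complex" and s
    assume F: "finite F" "F0 \<subseteq> F" "F \<subseteq> Z" and a': "\<forall>i\<in>Z. norm (a i) \<le> M i" and s: "(a has_sum s) Z"
    note a = bspec[OF a']
    have M0: "M i \<ge> 0" if "i \<in> Z" for i
      using a[OF that] norm_ge_zero[of "a i"] by linarith
    have d: "(a has_sum (s - sum a F)) (Z - F)" "(M has_sum (m - sum M F)) (Z - F)"
      using F by (intro has_sum_Diff s m has_sum_finite; blast)+
    have abs: "(\<lambda>i. norm (a i)) summable_on (Z - F)"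
      using d(2) a by (intro Infinite_Sum.abs_summable_on_comparison_test'[of M]) (auto simp: summable_on_def)
    have "norm (s - sum a F) = norm (infsum a (Z - F))"
      using d(1) by (simp add: infsumI)
    also have "\<dots> \<le> infsum (\<lambda>i. norm (a i)) (Z - F)"
      by (rule norm_infsum_bound[OF abs])
    also have "\<dots> \<le> infsum M (Z - F)"
      using abs d(2) a by (intro infsum_mono) (auto simp: summable_on_def)
    also have "\<dots> = m - sum M F" using d(2) by (simp add: infsumI)
    also have "\<dots> \<le> m - sum M F0"
      using sum_mono2[OF F(1,2), of M] F(3) M0 by auto
    also have "\<dots> \<le> e / 2" using F0(3) unfolding dist_real_def by linarith
    finally show "norm (s - sum a F) < e" using assms(2) by simp
  qed
qed

lemma has_sum_complex_nonneg:
  assumes "(a has_sum s) Z" and "\<And>i. i \<in> Z \<Longrightarrow> a i \<ge> (0 :: complex)"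
  shows "s \<ge> 0"
proof -
  have "Re s \<ge> 0"
    using has_sum_nonneg[OF has_sum_Re[OF assms(1)]] assms(2) by (auto simp: less_eq_complex_def)
  moreover have "((\<lambda>i. 0) has_sum Im s) Z"
    using has_sum_Im[OF assms(1)] assms(2) by (subst has_sum_cong[of _ _ "\<lambda>i. Im (a i)"]) (auto simp: less_eq_complex_def)
  then have "Im s = 0" by (simp add: has_sum_unique[OF _ has_sum_0])
  ultimately show ?thesis by (simp add: less_eq_complex_def)
qed

lemma has_sum_finite_sum:
  assumes "\<And>j. j \<in> J \<Longrightarrow> ((\<lambda>i. a i j :: complex) has_sum s j) Z"
  shows "((\<lambda>i. \<Sum>j\<in>J. a i j) has_sum (\<Sum>j\<in>J. s j)) Z"
  using assms by (induction J rule: infinite_finite_induct) (auto intro!: has_sum_add has_sum_0)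

section \<open>Fourier coefficients and Bessel's inequality\<close>

context compact_gelfand_pair
begin

text \<open>For spherical \<open>\<phi>\<close>, \<open>delta \<phi>\<close> is the reciprocal of
  \<open>sq \<phi>\<close>, so this is the coefficient of \<open>\<phi>\<close> in an expansion by
  the orthogonal, but not normalised, spherical functions.\<close>

definition coef :: "('g \<Rightarrow> complex) \<Rightarrow> ('g \<Rightarrow> complex) \<Rightarrow> complex" where
  "coef F \<phi> = of_nat (delta \<phi>) * ip F \<phi>"

lemma delta_Zsph_complex: "\<phi> \<in> Zsph N \<Longrightarrow> of_nat (delta \<phi>) * complex_of_real (sq \<phi>) = 1"
  using arg_cong[OF delta_Zsph, of \<phi> complex_of_real] by simp

lemma ip_Zsph:
  assumes "\<phi> \<in> Zsph N" and "\<psi> \<in> Zsph N"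
  shows "ip \<phi> \<psi> = (if \<phi> = \<psi> then complex_of_real (sq \<psi>) else 0)"
  using Zsph_orthogonal[OF assms] ip_self[OF Zsph_continuous[OF assms(2)]] by auto

lemma ip_translate_left_Zsph:
  assumes \<psi>: "\<psi> \<in> Zsph N" and F: "F \<in> alg"
  shows "ip (\<lambda>z. F (- y + z)) \<psi> = cnj (\<psi> y) * ip F \<psi>"
proof -
  have c: "continuous_on UNIV (\<lambda>z. F (- y + z) * cnj (\<psi> z))"
    by (intro continuous_intros continuous_comp[OF alg_continuous[OF F]] Zsph_continuous \<psi>)
  have "ip (\<lambda>z. F (- y + z)) \<psi> = ip F (\<lambda>z. \<psi> (y + z))"
    using integral_translate_left[OF c, of y] by (simp add: add.assoc[symmetric])
  also have "\<dots> = cnj (\<psi> y) * ip F \<psi>"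
    by (rule ip_translate_Zsph[OF \<psi> alg_continuous[OF F] bi_invariantD(1)[OF alg_bi_invariant[OF F]]])
  finally show ?thesis .
qed

text \<open>Weighting the kernel of \<open>F\<close> with \<open>\<phi> y\<close> and
  \<open>cnj (\<phi> z)\<close> keeps it positive. The inner integral splits off
  \<open>cnj (\<phi> y)\<close>, so the double integral is
  \<open>ip F \<phi> * sq \<phi>\<close>.\<close>

lemma ip_pos_def_Zsph_nonneg:
  assumes F: "F \<in> alg" "pos_def F" and \<phi>: "\<phi> \<in> Zsph N"
  shows "ip F \<phi> \<ge> 0"
proof -
  note c = continuous_comp[OF alg_continuous[OF F(1)]] continuous_comp[OF Zsph_continuous[OF \<phi>]]
  have "psd_kernel (\<lambda>y z. \<phi> y * (F (- y + z) * cnj (\<phi> z)))"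
    unfolding psd_kernel_def
  proof (intro allI)
    fix n :: nat and x :: "nat \<Rightarrow> 'g" and d :: "nat \<Rightarrow> complex"
    have "0 \<le> (\<Sum>j<n. \<Sum>k<n. F (- x j + x k) * (d j * \<phi> (x j)) * cnj (d k * \<phi> (x k)))"
      using F(2) unfolding pos_def_def
      by (elim conjE allE[of _ n] allE[of _ x] allE[of _ "\<lambda>j. d j * \<phi> (x j)"])
    then show "0 \<le> (\<Sum>j<n. \<Sum>k<n. \<phi> (x j) * (F (- x j + x k) * cnj (\<phi> (x k))) * d j * cnj (d k))"
      by (simp add: mult_ac)
  qed
  then have "0 \<le> (\<integral>y. \<integral>z. \<phi> y * (F (- y + z) * cnj (\<phi> z)) \<partial>M \<partial>M)"
    by (intro psd_kernel_integral) (unfold split_beta, intro continuous_intros c)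
  also have "\<dots> = (\<integral>y. ip F \<phi> * (\<phi> y * cnj (\<phi> y)) \<partial>M)"
    unfolding integral_mult_right_zero[of M "\<phi> _"] ip_translate_left_Zsph[OF \<phi> F(1)] by (simp only: mult_ac)
  also have "\<dots> = ip F \<phi> * of_real (sq \<phi>)"
    by (simp only: integral_mult_right_zero ip_self[OF Zsph_continuous[OF \<phi>]])
  finally show ?thesis
    using sq_Zsph_pos[OF \<phi>] by (auto simp: less_eq_complex_def zero_le_mult_iff)
qed

lemma coef_nonneg:
  assumes "F \<in> alg" "pos_def F" "\<phi> \<in> Zsph N"
  shows "coef F \<phi> \<ge> 0"
  unfolding coef_def using ip_pos_def_Zsph_nonneg[OF assms]
  by (intro mult_nonneg_nonneg) (auto simp: less_eq_complex_def)

text \<open>Bessel's inequality: positivity of \<open>F\<close> is applied to the unit mass at the neutral element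
  minus the idempotent \<open>\<Sum>\<phi>\<in>I. \<delta>(\<phi>) \<phi>\<close>.\<close>

lemma sum_coef_le:
  assumes F: "F \<in> alg" "pos_def F" and I: "finite I" "I \<subseteq> Zsph N"
  shows "(\<Sum>\<phi>\<in>I. coef F \<phi>) \<le> F 0"
proof -
  define p where "p = (\<lambda>x. \<Sum>\<phi>\<in>I. of_nat (delta \<phi>) * \<phi> x)"
  define S where "S = (\<Sum>\<phi>\<in>I. coef F \<phi>)"
  have Ic: "continuous_on UNIV \<phi>" if "\<phi> \<in> I" for \<phi>
    using that I Zsph_continuous by auto
  note Fc = alg_continuous[OF F(1)]
  have pc: "continuous_on UNIV p"
    unfolding p_def by (intro continuous_intros Ic)
  have ip_p: "ip F p = S"
    unfolding p_def S_def coef_def using ip_sum_right[OF Ic Fc, where a = "\<lambda>\<phi>. of_nat (delta \<phi>)"] by simp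
  have ip_tr: "ip (\<lambda>z. F (- y + z)) p = (\<Sum>\<psi>\<in>I. coef F \<psi> * cnj (\<psi> y))" for y
  proof -
    have "ip (\<lambda>z. F (- y + z)) p = (\<Sum>\<psi>\<in>I. cnj (of_nat (delta \<psi>)) * ip (\<lambda>z. F (- y + z)) \<psi>)"
      unfolding p_def by (intro ip_sum_right Ic continuous_comp[OF Fc] continuous_intros)
    also have "\<dots> = (\<Sum>\<psi>\<in>I. coef F \<psi> * cnj (\<psi> y))"
      using I by (intro sum.cong refl, subst ip_translate_left_Zsph[OF _ F(1)]) (auto simp: coef_def)
    finally show ?thesis .
  qed
  \<comment> \<open>The factors \<open>delta\<close> in \<open>p\<close> are what normalises these
    inner products, by \<open>delta \<psi> * sq \<psi> = 1\<close>.\<close>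
  have p_perp: "ip p \<psi> = 1" if "\<psi> \<in> I" for \<psi>
  proof -
    have "ip p \<psi> = (\<Sum>\<phi>\<in>I. of_nat (delta \<phi>) * ip \<phi> \<psi>)"
      unfolding p_def by (intro ip_sum_left Ic that)
    also have "\<dots> = (\<Sum>\<phi>\<in>I. if \<phi> = \<psi> then 1 else 0)"
    proof (intro sum.cong refl)
      fix \<phi> assume "\<phi> \<in> I"
      then have "\<phi> \<in> Zsph N" "\<psi> \<in> Zsph N" using I that by auto
      then show "of_nat (delta \<phi>) * ip \<phi> \<psi> = (if \<phi> = \<psi> then 1 else 0)"
        using delta_Zsph_complex[of \<psi>] by (cases "\<phi> = \<psi>") (simp_all only: ip_Zsph, simp_all)
    qed
    also have "\<dots> = 1" using I that by simp
    finally show ?thesis .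
  qed
  have i: "integrable M (\<lambda>z. F (- y + z) * cnj (p z))" for y
    by (intro integrable_ip continuous_comp[OF Fc] pc continuous_intros)
  have i0: "integrable M (\<lambda>z. F z * cnj (p z))"
    by (intro integrable_ip Fc pc)
  let ?H = "\<lambda>y z. F (- 0 + 0) + F (- 0 + z) * cnj (- p z) + (- p y) * F (- y + 0) + (- p y) * cnj (- p z) * F (- y + z)"
  have "psd_kernel ?H"
    by (rule psd_kernel_extra_point[OF pos_def_psd_kernel[OF F(2)]])
  then have "0 \<le> (\<integral>y. \<integral>z. ?H y z \<partial>M \<partial>M)"
    by (intro psd_kernel_integral) (unfold split_beta, intro continuous_intros continuous_comp[OF Fc] continuous_comp[OF pc])
  also have "(\<lambda>y. \<integral>z. ?H y z \<partial>M) = (\<lambda>y. F 0 - S - p y * cnj (F y) + (\<Sum>\<psi>\<in>I. coef F \<psi> * (p y * cnj (\<psi> y))))"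
  proof
    fix y
    have "(\<integral>z. ?H y z \<partial>M) = (\<integral>z. F 0 - F z * cnj (p z) - p y * cnj (F y) + p y * (F (- y + z) * cnj (p z)) \<partial>M)"
      by (simp add: pos_def_uminus[OF F(2)] mult_ac)
    also have "\<dots> = F 0 - S - p y * cnj (F y) + p y * (\<Sum>\<psi>\<in>I. coef F \<psi> * cnj (\<psi> y))"
      using i[of y] i0 by (simp add: ip_p ip_tr space_UNIV measure_UNIV)
    finally show "(\<integral>z. ?H y z \<partial>M) = F 0 - S - p y * cnj (F y) + (\<Sum>\<psi>\<in>I. coef F \<psi> * (p y * cnj (\<psi> y)))"
      by (simp add: sum_distrib_left mult.left_commute)
  qed
  also have "(\<integral>y. F 0 - S - p y * cnj (F y) + (\<Sum>\<psi>\<in>I. coef F \<psi> * (p y * cnj (\<psi> y))) \<partial>M) = F 0 - S - ip p F + (\<Sum>\<psi>\<in>I. coef F \<psi> * ip p \<psi>)"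
    using integrable_ip[OF pc Fc] integrable_ip[OF pc Ic] by (simp add: space_UNIV measure_UNIV)
  also have "(\<Sum>\<psi>\<in>I. coef F \<psi> * ip p \<psi>) = S"
    unfolding S_def by (intro sum.cong refl) (simp only: p_perp mult_1_right)
  also have "ip p F = cnj S"
    by (simp only: ip_cnj[of F p, symmetric] ip_p)
  \<comment> \<open>The quadratic term \<open>S\<close> has cancelled the linear term
    \<open>- S\<close>; the remaining \<open>cnj S\<close> is \<open>S\<close> because
    \<open>S \<ge> 0\<close>.\<close>
  finally have "0 \<le> F 0 - cnj S" by simp
  moreover have "S \<ge> 0"
    unfolding S_def using I by (intro sum_nonneg coef_nonneg F) auto
  ultimately show ?thesis
    by (simp add: S_def[symmetric] less_eq_complex_def)
qed

text \<open>Uniform approximation passes through the inner product with \<open>\<psi>\<close>, where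
  orthogonality leaves a single term.\<close>

lemma ip_uniform_expansion:
  assumes g: "continuous_on UNIV g" and \<psi>: "\<psi> \<in> Zsph N"
    and approx: "\<And>e. e > 0 \<Longrightarrow> \<exists>F0. finite F0 \<and> F0 \<subseteq> Zsph N \<and>
        (\<forall>F. finite F \<and> F0 \<subseteq> F \<and> F \<subseteq> Zsph N \<longrightarrow> (\<forall>x. norm (g x - (\<Sum>\<phi>\<in>F. a \<phi> * \<phi> x)) < e))"
  shows "a \<psi> = coef g \<psi>"
proof -
  have "dist (ip g \<psi>) (a \<psi> * sq \<psi>) \<le> e" if "e > 0" for e
  proof -
    obtain F0 where F0: "finite F0" "F0 \<subseteq> Zsph N" "\<forall>F. finite F \<and> F0 \<subseteq> F \<and> F \<subseteq> Zsph N \<longrightarrow>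
        (\<forall>x. norm (g x - (\<Sum>\<phi>\<in>F. a \<phi> * \<phi> x)) < e)"
      using approx[OF \<open>e > 0\<close>] by (elim exE conjE)
    \<comment> \<open>Adjoining \<open>\<psi>\<close> guarantees that its term is among those
      summed; the approximation persists for every larger finite set.\<close>
    define F where "F = insert \<psi> F0"
    have F: "finite F" "F \<subseteq> Zsph N" "F0 \<subseteq> F" "\<psi> \<in> F" using F0 \<psi> by (auto simp: F_def)
    have Fc: "continuous_on UNIV \<phi>" if "\<phi> \<in> F" for \<phi>
      using that F Zsph_continuous by auto
    let ?s = "\<lambda>x. \<Sum>\<phi>\<in>F. a \<phi> * \<phi> x"
    have sc: "continuous_on UNIV ?s" by (intro continuous_intros Fc)
    have "ip ?s \<psi> = (\<Sum>\<phi>\<in>F. a \<phi> * ip \<phi> \<psi>)"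
      by (intro ip_sum_left Fc F)
    also have "\<dots> = (\<Sum>\<phi>\<in>F. if \<phi> = \<psi> then a \<psi> * sq \<psi> else 0)"
    proof (intro sum.cong refl)
      fix \<phi> assume "\<phi> \<in> F"
      then have "\<phi> \<in> Zsph N" using F by auto
      then show "a \<phi> * ip \<phi> \<psi> = (if \<phi> = \<psi> then a \<psi> * sq \<psi> else 0)"
        by (simp only: ip_Zsph[OF _ \<psi>]) simp
    qed
    also have "\<dots> = a \<psi> * sq \<psi>" using F by simp
    finally have "dist (ip g \<psi>) (a \<psi> * sq \<psi>) = norm (ip (\<lambda>x. g x - ?s x) \<psi>)"
      by (simp only: ip_diff_left[OF g sc Zsph_continuous[OF \<psi>]] dist_norm)
    also have "\<dots> \<le> e"
    proof (intro norm_integral_le integrable_ip continuous_on_diff g sc Zsph_continuous \<psi>)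
      fix x
      have "norm (g x - ?s x) * norm (\<psi> x) \<le> e * 1"
        using F0(3)[rule_format, OF conjI[OF F(1) conjI[OF F(3,2)]], of x] norm_Zsph_le[OF \<psi>, of x] \<open>e > 0\<close> by (intro mult_mono) auto
      then show "norm ((g x - ?s x) * cnj (\<psi> x)) \<le> e" by (simp add: norm_mult)
    qed
    finally show ?thesis .
  qed
  then have "dist (ip g \<psi>) (a \<psi> * sq \<psi>) \<le> 0"
    using field_le_epsilon[of "dist (ip g \<psi>) (a \<psi> * sq \<psi>)" 0] by simp
  then have "ip g \<psi> = a \<psi> * sq \<psi>" by simp
  then show ?thesis
    using delta_Zsph_complex[OF \<psi>] by (simp add: coef_def mult.left_commute)
qed

end

section \<open>The expansion theorem\<close>

lemma sum_swap_middle: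
  "(\<Sum>a\<in>A. \<Sum>b\<in>B. \<Sum>j\<in>J. \<Sum>k\<in>J'. g a b j k) = (\<Sum>a\<in>A. \<Sum>j\<in>J. \<Sum>b\<in>B. \<Sum>k\<in>J'. g a b j k)"
  by (intro sum.cong refl sum.swap)

context compact_gelfand_pair
begin

text \<open>As \<open>cmod (\<phi> x) \<le> 1\<close> and
  \<open>cmod (B \<phi> u) \<le> Re (B \<phi> 0)\<close>, the numbers \<open>Re (B \<phi> 0)\<close>
  are a summable majorant independent of \<open>x\<close> and \<open>u\<close>.\<close>

lemma expansion_uniform:
  fixes B :: "('g \<Rightarrow> complex) \<Rightarrow> 'l::topological_group_add \<Rightarrow> complex"
  assumes B: "\<forall>\<phi>\<in>Zsph N. pos_def (B \<phi>)" and "(\<lambda>\<phi>. B \<phi> 0) summable_on Zsph N"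
    and "e > 0"
  obtains F0 where "finite F0" and "F0 \<subseteq> Zsph N"
    and "\<And>F x u s. finite F \<Longrightarrow> F0 \<subseteq> F \<Longrightarrow> F \<subseteq> Zsph N \<Longrightarrow>
          ((\<lambda>\<phi>. B \<phi> u * \<phi> x) has_sum s) (Zsph N) \<Longrightarrow> norm (s - (\<Sum>\<phi>\<in>F. B \<phi> u * \<phi> x)) < e"
proof -
  have "(\<lambda>\<phi>. Re (B \<phi> 0)) summable_on Zsph N"
    by (rule summable_on_Re[OF assms(2)])
  then obtain F0 where F0: "finite F0" "F0 \<subseteq> Zsph N"
    "\<And>F a s. finite F \<Longrightarrow> F0 \<subseteq> F \<Longrightarrow> F \<subseteq> Zsph N \<Longrightarrow>
      \<forall>\<phi>\<in>Zsph N. norm (a \<phi> :: complex) \<le> Re (B \<phi> 0) \<Longrightarrow>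
      (a has_sum s) (Zsph N) \<Longrightarrow> norm (s - sum a F) < e"
    by (rule has_sum_tail_uniform[OF _ \<open>e > 0\<close>]) (rule that)
  have "norm (B \<phi> u * \<phi> x) \<le> Re (B \<phi> 0)" if "\<phi> \<in> Zsph N" for \<phi> u x
    using mult_mono[OF norm_pos_def_le[OF bspec[OF B that], of u] norm_Zsph_le[OF that, of x]]
      order_trans[OF norm_ge_zero norm_pos_def_le[OF bspec[OF B that], of u]]
    by (simp add: norm_mult)
  then show ?thesis
    by (intro that[OF F0(1,2)] F0(3)) auto
qed

section \<open>The two implications for a fixed continuous \<open>f\<close>\<close>

context
  fixes f :: "'g \<times> 'l::topological_group_add \<Rightarrow> complex"
  assumes f_cont: "continuous_on UNIV f"
begin

lemma f_curried: "continuous_on UNIV (\<lambda>(u, x). f (x, u))"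
  unfolding split_beta by (intro continuous_comp[OF f_cont] continuous_intros)

lemma f_slice: "continuous_on UNIV (\<lambda>x. f (x, u))"
  by (rule continuous_slice[OF f_curried])

lemma P_sharp_slice_alg: "P_sharp K f \<Longrightarrow> (\<lambda>x. f (x, u)) \<in> alg"
  by (intro algI f_slice) (simp add: bi_invariant_def P_sharp_def)

text \<open>Collapsing the second variable by a quadratic form leaves a positive definite function
  on the first group. Nonnegativity of its coefficient at \<open>\<phi>\<close>, for all
  \<open>u\<close> and \<open>c\<close>, is exactly the positivity required of
  \<open>u \<mapsto> coef (\<lambda>x. f (x, u)) \<phi>\<close>.\<close>

lemma P_sharp_average:
  fixes n :: nat
  assumes f: "P_sharp K f"
  defines "F \<equiv> \<lambda>u c x. \<Sum>j<n. \<Sum>k<n. f (x, - u j + u k) * c j * cnj (c k)"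
  shows "F u c \<in> alg" and "pos_def (F u c)"
proof -
  have F_cont: "continuous_on UNIV (F u c)"
    unfolding F_def by (intro continuous_intros f_slice)
  then show "F u c \<in> alg"
    using f by (intro algI) (simp_all add: bi_invariant_def P_sharp_def F_def)
  have psd: "psd_kernel (\<lambda>p q. f (- fst p + fst q, - snd p + snd q))"
    unfolding psd_kernel_def
  proof (intro allI)
    fix n :: nat and x :: "nat \<Rightarrow> 'g \<times> 'l" and d :: "nat \<Rightarrow> complex"
    show "0 \<le> (\<Sum>j<n. \<Sum>k<n. f (- fst (x j) + fst (x k), - snd (x j) + snd (x k)) * d j * cnj (d k))"
      using f unfolding P_sharp_def
      by (elim conjE allE[of _ n] allE[of _ "\<lambda>j. fst (x j)"] allE[of _ "\<lambda>j. snd (x j)"] allE[of _ d])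
  qed
  show "pos_def (F u c)"
    unfolding pos_def_def
  proof (intro conjI allI F_cont)
    fix m :: nat and x :: "nat \<Rightarrow> 'g" and d :: "nat \<Rightarrow> complex"
    \<comment> \<open>All pairs of a point \<open>x a\<close> and a point \<open>u j\<close> are
      used at once, with the product weights \<open>d a * c j\<close>.\<close>
    have "0 \<le> (\<Sum>p\<in>{..<m} \<times> {..<n}. \<Sum>q\<in>{..<m} \<times> {..<n}.
        f (- x (fst p) + x (fst q), - u (snd p) + u (snd q)) * (d (fst p) * c (snd p)) * cnj (d (fst q) * c (snd q)))"
      using psd_kernel_sum[OF psd, of "{..<m} \<times> {..<n}" "\<lambda>p. (x (fst p), u (snd p))" "\<lambda>p. d (fst p) * c (snd p)"]
      by simp
    also have "\<dots> = (\<Sum>a<m. \<Sum>j<n. \<Sum>b<m. \<Sum>k<n.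
        f (- x a + x b, - u j + u k) * (d a * c j) * cnj (d b * c k))"
      by (simp only: sum.cartesian_product' fst_conv snd_conv)
    also have "\<dots> = (\<Sum>a<m. \<Sum>b<m. \<Sum>j<n. \<Sum>k<n.
        f (- x a + x b, - u j + u k) * (d a * c j) * cnj (d b * c k))"
      by (rule sum_swap_middle[symmetric])
    also have "\<dots> = (\<Sum>a<m. \<Sum>b<m. F u c (- x a + x b) * d a * cnj (d b))"
      by (simp add: F_def sum_distrib_left sum_distrib_right mult_ac)
    finally show "0 \<le> (\<Sum>a<m. \<Sum>b<m. F u c (- x a + x b) * d a * cnj (d b))" .
  qed
qed

lemma P_sharp_coef_pos_def:
  assumes f: "P_sharp K f" and \<phi>: "\<phi> \<in> Zsph N"
  shows "pos_def (\<lambda>u. coef (\<lambda>x. f (x, u)) \<phi>)"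
  unfolding pos_def_def
proof (intro conjI allI)
  have c: "continuous_on UNIV (\<lambda>(u, x). f (x, u) * cnj (\<phi> x))"
    unfolding split_beta
    by (intro continuous_intros continuous_comp[OF f_cont] continuous_comp[OF Zsph_continuous[OF \<phi>]])
  show "continuous_on UNIV (\<lambda>u. coef (\<lambda>x. f (x, u)) \<phi>)"
    unfolding coef_def by (intro continuous_intros continuous_on_integral c)
  fix n :: nat and u :: "nat \<Rightarrow> 'l" and c :: "nat \<Rightarrow> complex"
  have i: "integrable M (\<lambda>x. f (x, v) * cnj (\<phi> x))" for v
    by (intro integrable_ip f_slice Zsph_continuous \<phi>)
  have "coef (\<lambda>x. \<Sum>j<n. \<Sum>k<n. f (x, - u j + u k) * c j * cnj (c k)) \<phi> =
      of_nat (delta \<phi>) * (\<integral>x. (\<Sum>j<n. \<Sum>k<n. c j * cnj (c k) * (f (x, - u j + u k) * cnj (\<phi> x))) \<partial>M)"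
    by (simp add: coef_def sum_distrib_left sum_distrib_right mult_ac)
  also have "\<dots> = of_nat (delta \<phi>) * (\<Sum>j<n. \<Sum>k<n. c j * cnj (c k) * ip (\<lambda>x. f (x, - u j + u k)) \<phi>)"
    using i by simp
  also have "\<dots> = (\<Sum>j<n. \<Sum>k<n. coef (\<lambda>x. f (x, - u j + u k)) \<phi> * c j * cnj (c k))"
    by (simp add: coef_def sum_distrib_left mult_ac)
  finally show "0 \<le> (\<Sum>j<n. \<Sum>k<n. coef (\<lambda>x. f (x, - u j + u k)) \<phi> * c j * cnj (c k))"
    using coef_nonneg[OF P_sharp_average[OF f, where n = n and u = u and c = c] \<phi>] by simp
qed

lemma P_sharp_coef_summable:
  assumes f: "P_sharp K f"
  shows "(\<lambda>\<phi>. coef (\<lambda>x. f (x, 0)) \<phi>) summable_on Zsph N"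
proof -
  let ?F = "\<lambda>x. f (x, 0)"
  have F: "?F \<in> alg" "pos_def ?F"
    \<comment> \<open>With a single point and weight 1 the quadratic form reduces to the slice of
      \<open>f\<close> at the neutral element.\<close>
    using P_sharp_average[OF f, where n = 1 and u = "\<lambda>_. 0" and c = "\<lambda>_. 1"] by simp_all
  have nn: "coef ?F \<phi> \<ge> 0" if "\<phi> \<in> Zsph N" for \<phi>
    by (rule coef_nonneg[OF F that])
  have "(\<lambda>\<phi>. Re (coef ?F \<phi>)) summable_on Zsph N"
  proof (rule nonneg_bdd_above_summable_on)
    show "Re (coef ?F \<phi>) \<ge> 0" if "\<phi> \<in> Zsph N" for \<phi>
      using nn[OF that] by (simp add: less_eq_complex_def)
    show "bdd_above (sum (\<lambda>\<phi>. Re (coef ?F \<phi>)) ` {I. I \<subseteq> Zsph N \<and> finite I})"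
    proof (rule bdd_aboveI2)
      fix I assume "I \<in> {I. I \<subseteq> Zsph N \<and> finite I}"
      then show "(\<Sum>\<phi>\<in>I. Re (coef ?F \<phi>)) \<le> Re (?F 0)"
        using sum_coef_le[OF F, of I] by (simp add: less_eq_complex_def)
    qed
  qed
  then have "(\<lambda>\<phi>. complex_of_real (Re (coef ?F \<phi>))) summable_on Zsph N"
    using has_sum_of_real unfolding summable_on_def by blast
  also have "?this \<longleftrightarrow> ?thesis"
    using nn by (intro summable_on_cong) (auto simp: less_eq_complex_def complex_eq_iff)
  finally show ?thesis .
qed

text \<open>The sum \<open>S\<close> of the series is continuous as a uniform limit, bi-invariant
  term by term, and has the same coefficients as the slice of \<open>f\<close>; completeness then
  forces the two to agree.\<close>

lemma P_sharp_expansion: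
  assumes f: "P_sharp K f"
  shows "((\<lambda>\<phi>. coef (\<lambda>x. f (x, u)) \<phi> * \<phi> x) has_sum f (x, u)) (Zsph N)"
proof -
  define B where "B \<phi> u = coef (\<lambda>x. f (x, u)) \<phi>" for \<phi> u
  have B: "\<forall>\<phi>\<in>Zsph N. pos_def (B \<phi>)"
    unfolding B_def using P_sharp_coef_pos_def[OF f] by blast
  have B_sum: "(\<lambda>\<phi>. B \<phi> 0) summable_on Zsph N"
    unfolding B_def by (rule P_sharp_coef_summable[OF f])
  have bound: "norm (B \<phi> u * \<phi> x) \<le> Re (B \<phi> 0)" if "\<phi> \<in> Zsph N" for \<phi> x
    using mult_mono[OF norm_pos_def_le[OF bspec[OF B that], of u] norm_Zsph_le[OF that, of x]]
      order_trans[OF norm_ge_zero norm_pos_def_le[OF bspec[OF B that], of u]]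
    by (simp add: norm_mult)
  define S where "S x = (\<Sum>\<^sub>\<infinity>\<phi>\<in>Zsph N. B \<phi> u * \<phi> x)" for x
  have "(\<lambda>\<phi>. norm (B \<phi> u * \<phi> x)) summable_on Zsph N" for x
    using bound by (intro Infinite_Sum.abs_summable_on_comparison_test'[OF summable_on_Re[OF B_sum]]) auto
  then have S: "((\<lambda>\<phi>. B \<phi> u * \<phi> x) has_sum S x) (Zsph N)" for x
    unfolding S_def by (rule has_sum_infsum[OF Infinite_Sum.abs_summable_summable])
  have approx: "\<exists>F0. finite F0 \<and> F0 \<subseteq> Zsph N \<and>
        (\<forall>F. finite F \<and> F0 \<subseteq> F \<and> F \<subseteq> Zsph N \<longrightarrow> (\<forall>x. norm (S x - (\<Sum>\<phi>\<in>F. B \<phi> u * \<phi> x)) < e))"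
    if e: "e > 0" for e
  proof -
    obtain F0 where F0: "finite F0" "F0 \<subseteq> Zsph N"
      "\<And>F x u s. finite F \<Longrightarrow> F0 \<subseteq> F \<Longrightarrow> F \<subseteq> Zsph N \<Longrightarrow>
          ((\<lambda>\<phi>. B \<phi> u * \<phi> x) has_sum s) (Zsph N) \<Longrightarrow> norm (s - (\<Sum>\<phi>\<in>F. B \<phi> u * \<phi> x)) < e"
      by (rule expansion_uniform[OF B B_sum e]) (rule that)
    then show ?thesis using S by (intro exI[of _ F0]) auto
  qed
  have S_cont: "continuous_on UNIV S"
  proof -
    have "uniform_limit UNIV (\<lambda>F x. \<Sum>\<phi>\<in>F. B \<phi> u * \<phi> x) S (finite_subsets_at_top (Zsph N))"
    proof (rule uniform_limitI)
      fix e :: real assume e: "e > 0"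
      obtain F0 where "finite F0" "F0 \<subseteq> Zsph N"
        "\<forall>F. finite F \<and> F0 \<subseteq> F \<and> F \<subseteq> Zsph N \<longrightarrow> (\<forall>x. norm (S x - (\<Sum>\<phi>\<in>F. B \<phi> u * \<phi> x)) < e)"
        using approx[OF e] by (elim exE conjE)
      then show "\<forall>\<^sub>F F in finite_subsets_at_top (Zsph N). \<forall>x\<in>UNIV. dist (\<Sum>\<phi>\<in>F. B \<phi> u * \<phi> x) (S x) < e"
        unfolding eventually_finite_subsets_at_top by (intro exI[of _ F0]) (auto simp: dist_norm norm_minus_commute)
    qed
    moreover have "\<forall>\<^sub>F F in finite_subsets_at_top (Zsph N). continuous_on UNIV (\<lambda>x. \<Sum>\<phi>\<in>F. B \<phi> u * \<phi> x)"
      by (rule eventually_finite_subsets_at_top_weakI, intro continuous_intros Zsph_continuous) blast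
    ultimately show ?thesis
      by (intro uniform_limit_theorem) (auto simp: finite_subsets_at_top_neq_bot)
  qed
  have S_alg: "S \<in> alg"
  proof (rule algI[OF S_cont bi_invariantI])
    fix k x assume k: "k \<in> K"
    have "\<phi> (k + x) = \<phi> x" "\<phi> (x + k) = \<phi> x" if "\<phi> \<in> Zsph N" for \<phi>
      using bi_invariantD[OF Zsph_bi_invariant[OF that] k] by auto
    then show "S (k + x) = S x" "S (x + k) = S x"
      unfolding S_def by (auto intro!: infsum_cong)
  qed
  have "f (x, u) - S x = 0"
  proof (rule Zsph_complete[of "\<lambda>x. f (x, u) - S x"])
    show "(\<lambda>x. f (x, u) - S x) \<in> alg"
      by (intro alg_diff P_sharp_slice_alg f S_alg)
    fix \<phi> assume \<phi>: "\<phi> \<in> Zsph N"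
    have "coef (\<lambda>x. f (x, u)) \<phi> = coef S \<phi>"
      using ip_uniform_expansion[OF S_cont \<phi>, of "\<lambda>\<phi>. B \<phi> u"] approx by (simp add: B_def)
    moreover have "of_nat (delta \<phi>) \<noteq> (0 :: complex)"
      using delta_Zsph_complex[OF \<phi>] by (metis mult_zero_left zero_neq_one)
    ultimately have "ip (\<lambda>x. f (x, u)) \<phi> = ip S \<phi>"
      by (simp add: coef_def)
    then show "ip (\<lambda>x. f (x, u) - S x) \<phi> = 0"
      by (simp only: ip_diff_left[OF f_slice S_cont Zsph_continuous[OF \<phi>]] right_minus_eq)
  qed
  then show ?thesis using S[of x] by (simp add: B_def)
qed

text \<open>Each term is positive definite on the product by the Schur product argument, and
  positivity and bi-invariance survive summation.\<close>

lemma expansion_P_sharp: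
  assumes B: "\<And>\<phi>. \<phi> \<in> Zsph N \<Longrightarrow> pos_def (B \<phi>)"
    and sum: "\<And>x u. ((\<lambda>\<phi>. B \<phi> u * \<phi> x) has_sum f (x, u)) (Zsph N)"
  shows "P_sharp K f"
  unfolding P_sharp_def
proof (intro conjI allI ballI f_cont)
  fix n :: nat and x :: "nat \<Rightarrow> 'g" and u :: "nat \<Rightarrow> 'l" and c :: "nat \<Rightarrow> complex"
  have "((\<lambda>\<phi>. \<Sum>j<n. \<Sum>k<n. B \<phi> (- u j + u k) * \<phi> (- x j + x k) * c j * cnj (c k)) has_sum
      (\<Sum>j<n. \<Sum>k<n. f (- x j + x k, - u j + u k) * c j * cnj (c k))) (Zsph N)"
    by (intro has_sum_finite_sum has_sum_cmult_left sum)
  then show "0 \<le> (\<Sum>j<n. \<Sum>k<n. f (- x j + x k, - u j + u k) * c j * cnj (c k))"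
    by (rule has_sum_complex_nonneg) (rule Zsph_mult_psd_kernel[OF _ pos_def_psd_kernel[OF B]])
next
  fix k l x u assume k: "k \<in> K" "l \<in> K"
  have "((\<lambda>\<phi>. B \<phi> u * \<phi> x) has_sum f (k + x + l, u)) (Zsph N)"
  proof (rule has_sum_cong[THEN iffD1, OF _ sum[of u "k + x + l"]])
    fix \<phi> assume "\<phi> \<in> Zsph N"
    then show "B \<phi> u * \<phi> (k + x + l) = B \<phi> u * \<phi> x"
      using Zsph_bi_invariant k unfolding bi_invariant_def by metis
  qed
  then show "f (k + x + l, u) = f (x, u)"
    using sum has_sum_unique by blast
qed

end

end

text \<open>\<open>haar_prob\<close> describes a measure whose space is the subset \<open>K\<close>.
  Its image under the inclusion is a Borel measure on the whole group with the same integrals of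
  continuous functions; invariance transfers because translation by \<open>l \<in> K\<close> maps
  \<open>K\<close> onto itself.\<close>

lemma haar_prob_pushforward:
  fixes \<omega>K :: "'g::{topological_group_add, t2_space} measure" and h :: "'g \<Rightarrow> complex"
  assumes G: "compact (UNIV :: 'g set)" and K: "compact_subgroup K" and haar: "haar_prob \<omega>K K"
  defines "N \<equiv> distr \<omega>K borel (\<lambda>x. x)"
  shows "compact_borel_prob N" and "AE k in N. k \<in> K"
    and "l \<in> K \<Longrightarrow> continuous_on UNIV h \<Longrightarrow> (\<integral>k. h (l + k) \<partial>N) = (\<integral>k. h k \<partial>N)"
    and "continuous_on UNIV h \<Longrightarrow> (\<integral>k. h k \<partial>N) = (\<integral>k. h k \<partial>\<omega>K)"
proof -
  have sp: "space \<omega>K = K" and m1: "emeasure \<omega>K K = 1" and se: "sets \<omega>K = sets (restrict_space borel K)"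
    and inv: "\<And>g A. g \<in> K \<Longrightarrow> A \<in> sets \<omega>K \<Longrightarrow> emeasure \<omega>K ((\<lambda>y. g + y) ` A) = emeasure \<omega>K A"
    using haar by (auto simp: haar_prob_def)
  have Kc: "closed K" using K by (auto simp: compact_subgroup_def compact_imp_closed)
  then have Kb: "K \<in> sets borel" by simp
  have id: "(\<lambda>x. x) \<in> measurable \<omega>K borel"
    unfolding measurable_cong_sets[OF se refl] by (rule measurable_restrict_space1) simp
  have emN: "emeasure N A = emeasure \<omega>K (A \<inter> K)" if "A \<in> sets borel" for A
    using that by (simp add: N_def emeasure_distr[OF id that] sp vimage_def Collect_conj_eq)
  have setsN: "sets N = sets borel" by (simp add: N_def)
  show N: "compact_borel_prob N"
    by standard (use G m1 emN[of UNIV] setsN in auto)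
  interpret N: compact_borel_prob N by (rule N)
  show "AE k in N. k \<in> K"
    unfolding N_def by (subst AE_distr_iff[OF id]) (use Kb sp in \<open>auto simp: AE_space\<close>)
  show "(\<integral>k. h k \<partial>N) = (\<integral>k. h k \<partial>\<omega>K)" if "continuous_on UNIV h"
    unfolding N_def by (intro integral_distr id borel_measurable_continuous_onI that)
  show "(\<integral>k. h (l + k) \<partial>N) = (\<integral>k. h k \<partial>N)" if l: "l \<in> K" and h: "continuous_on UNIV h"
  proof -
    have tr: "(\<lambda>y. l + y) \<in> measurable N borel"
      by (intro N.borel_measurable_continuous continuous_intros)
    have "distr N borel (\<lambda>y. l + y) = N"
    proof (rule measure_eqI)
      fix A assume "A \<in> sets (distr N borel (\<lambda>y. l + y))"
      then have A: "A \<in> sets borel" by simp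
      have "A \<inter> K \<in> sets \<omega>K"
        using A Kb by (auto simp: se sets_restrict_space)
      moreover have "(\<lambda>y. l + y) -` A \<inter> K = (\<lambda>y. - l + y) ` (A \<inter> K)"
      proof (intro equalityI subsetI)
        fix y assume "y \<in> (\<lambda>y. l + y) -` A \<inter> K"
        then have "l + y \<in> A \<inter> K" "y = - l + (l + y)"
          using K l by (auto simp: compact_subgroup_def)
        then show "y \<in> (\<lambda>y. - l + y) ` (A \<inter> K)" by blast
      qed (use K l in \<open>auto simp: compact_subgroup_def\<close>)
      moreover have "- l \<in> K" using K l by (simp add: compact_subgroup_def)
      moreover have "(\<lambda>y. l + y) -` A \<in> sets borel"
        using measurable_sets[OF tr A] by (simp add: N.space_UNIV setsN)
      ultimately show "emeasure (distr N borel (\<lambda>y. l + y)) A = emeasure N A"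
        by (simp add: emeasure_distr[OF tr A] N.space_UNIV emN A inv)
    qed (simp add: setsN)
    then show ?thesis
      using integral_distr[OF tr, of h] borel_measurable_continuous_onI[OF h] by simp
  qed
qed

theorem theorem3p3:
  fixes \<omega>G :: "'g::{topological_group_add, t2_space} measure"
    and \<omega>K :: "'g measure"
    and K :: "'g set"
    and f :: "'g \<times> 'l::{topological_group_add, t2_space} \<Rightarrow> complex"
  assumes G_compact: "compact (UNIV :: 'g set)"
    and L_lc: "locally_compact_space (euclidean :: 'l topology)"
    and haarG: "haar_prob \<omega>G UNIV"
    and haarK: "haar_prob \<omega>K K"
    and gelfand: "gelfand_pair \<omega>G K"
    and f_cont: "continuous_on UNIV f"
  shows "(P_sharp K f \<longleftrightarrow>
            (\<exists>B :: ('g \<Rightarrow> complex) \<Rightarrow> 'l \<Rightarrow> complex.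
               (\<forall>\<phi>\<in>Zsph \<omega>K. pos_def (B \<phi>)) \<and>
               (\<lambda>\<phi>. B \<phi> 0) summable_on Zsph \<omega>K \<and>
               (\<forall>x u. ((\<lambda>\<phi>. B \<phi> u * \<phi> x) has_sum f (x, u)) (Zsph \<omega>K))))
       \<and> (\<forall>B :: ('g \<Rightarrow> complex) \<Rightarrow> 'l \<Rightarrow> complex.
            (\<forall>\<phi>\<in>Zsph \<omega>K. pos_def (B \<phi>)) \<and>
            (\<lambda>\<phi>. B \<phi> 0) summable_on Zsph \<omega>K \<and>
            (\<forall>x u. ((\<lambda>\<phi>. B \<phi> u * \<phi> x) has_sum f (x, u)) (Zsph \<omega>K)) \<longrightarrow>
              (\<forall>e>0. \<exists>F0. finite F0 \<and> F0 \<subseteq> Zsph \<omega>K \<and>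
                  (\<forall>F. finite F \<and> F0 \<subseteq> F \<and> F \<subseteq> Zsph \<omega>K \<longrightarrow>
                     (\<forall>x u. norm (f (x, u) - (\<Sum>\<phi>\<in>F. B \<phi> u * \<phi> x)) < e))) \<and>
              (\<forall>\<phi>\<in>Zsph \<omega>K. \<forall>u. B \<phi> u =
                  of_nat (delta \<phi>) * integral\<^sup>L \<omega>G (\<lambda>x. f (x, u) * cnj (\<phi> x))))"
proof -
  have K: "compact_subgroup K" using gelfand by (simp add: gelfand_pair_def)
  define N where "N = distr \<omega>K borel (\<lambda>x. x)"
  note N = haar_prob_pushforward[OF G_compact K haarK, folded N_def]
  interpret compact_borel_prob N by (rule N(1))
  interpret compact_gelfand_pair \<omega>G N K
  proof
    show "sets \<omega>G = sets borel" and "emeasure \<omega>G UNIV = 1"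
      using haarG by (simp_all add: haar_prob_def sets_restrict_space)
    then show "emeasure \<omega>G ((\<lambda>y. g + y) ` A) = emeasure \<omega>G A" if "A \<in> sets borel" for g A
      using haarG that by (simp add: haar_prob_def)
    \<comment> \<open>Every support is compact here, so the commutativity granted by
      \<open>gelfand_pair\<close> covers all continuous bi-invariant functions.\<close>
    have compact: "compact (closure S)" for S :: "'g set"
      using compact_Int_closed[OF G_compact closed_closure, of S] by simp
    show "convolution \<omega>G f g = convolution \<omega>G g f"
      if "continuous_on UNIV f" "bi_invariant K f" "continuous_on UNIV g" "bi_invariant K g" for f g
      using gelfand that compact unfolding gelfand_pair_def by blast
  qed (use G_compact N K in \<open>auto simp: compact_subgroup_def\<close>)
  \<comment> \<open>The functional equation integrates only continuous functions, on which
    \<open>N\<close> and \<open>\<omega>K\<close> agree, so both measures define the same spherical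
    functions.\<close>
  have Z: "Zsph \<omega>K = Zsph N"
  proof -
    have "(\<integral>k. \<phi> (x + k + y) \<partial>N) = (\<integral>k. \<phi> (x + k + y) \<partial>\<omega>K)" if "continuous_on UNIV \<phi>" for \<phi> :: "'g \<Rightarrow> complex" and x y
      by (intro N(4) continuous_comp[OF that] continuous_intros)
    then show ?thesis
      unfolding Zsph_def spherical_def by (intro Collect_cong) auto
  qed
  show ?thesis
    unfolding Z
  proof (intro conjI iffI allI impI)
    assume f: "P_sharp K f"
    show "\<exists>B :: ('g \<Rightarrow> complex) \<Rightarrow> 'l \<Rightarrow> complex. (\<forall>\<phi>\<in>Zsph N. pos_def (B \<phi>)) \<and>
        (\<lambda>\<phi>. B \<phi> 0) summable_on Zsph N \<and> (\<forall>x u. ((\<lambda>\<phi>. B \<phi> u * \<phi> x) has_sum f (x, u)) (Zsph N))"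
      using P_sharp_coef_pos_def[OF f_cont f] P_sharp_coef_summable[OF f_cont f] P_sharp_expansion[OF f_cont f]
      by (intro exI[of _ "\<lambda>\<phi> u. coef (\<lambda>x. f (x, u)) \<phi>"]) blast
  next
    assume "\<exists>B :: ('g \<Rightarrow> complex) \<Rightarrow> 'l \<Rightarrow> complex. (\<forall>\<phi>\<in>Zsph N. pos_def (B \<phi>)) \<and>
        (\<lambda>\<phi>. B \<phi> 0) summable_on Zsph N \<and> (\<forall>x u. ((\<lambda>\<phi>. B \<phi> u * \<phi> x) has_sum f (x, u)) (Zsph N))"
    then show "P_sharp K f"
      using expansion_P_sharp[OF f_cont] by blast
  next
    fix B :: "('g \<Rightarrow> complex) \<Rightarrow> 'l \<Rightarrow> complex" and e :: real
    assume "(\<forall>\<phi>\<in>Zsph N. pos_def (B \<phi>)) \<and>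
        (\<lambda>\<phi>. B \<phi> 0) summable_on Zsph N \<and> (\<forall>x u. ((\<lambda>\<phi>. B \<phi> u * \<phi> x) has_sum f (x, u)) (Zsph N))"
    then have B: "\<forall>\<phi>\<in>Zsph N. pos_def (B \<phi>)" and B_sum: "(\<lambda>\<phi>. B \<phi> 0) summable_on Zsph N"
      and sum: "\<And>x u. ((\<lambda>\<phi>. B \<phi> u * \<phi> x) has_sum f (x, u)) (Zsph N)" by auto
    have uniform: "\<exists>F0. finite F0 \<and> F0 \<subseteq> Zsph N \<and> (\<forall>F. finite F \<and> F0 \<subseteq> F \<and> F \<subseteq> Zsph N \<longrightarrow>
        (\<forall>x u. norm (f (x, u) - (\<Sum>\<phi>\<in>F. B \<phi> u * \<phi> x)) < e))" if e: "e > 0" for e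
    proof -
      obtain F0 where F0: "finite F0" "F0 \<subseteq> Zsph N"
        "\<And>F x u s. finite F \<Longrightarrow> F0 \<subseteq> F \<Longrightarrow> F \<subseteq> Zsph N \<Longrightarrow>
            ((\<lambda>\<phi>. B \<phi> u * \<phi> x) has_sum s) (Zsph N) \<Longrightarrow> norm (s - (\<Sum>\<phi>\<in>F. B \<phi> u * \<phi> x)) < e"
        by (rule expansion_uniform[OF B B_sum e]) (rule that)
      then show ?thesis using sum by (intro exI[of _ F0]) auto
    qed
    then show "\<exists>F0. finite F0 \<and> F0 \<subseteq> Zsph N \<and> (\<forall>F. finite F \<and> F0 \<subseteq> F \<and> F \<subseteq> Zsph N \<longrightarrow>
        (\<forall>x u. norm (f (x, u) - (\<Sum>\<phi>\<in>F. B \<phi> u * \<phi> x)) < e))" if "e > 0"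
      using that .
    show "\<forall>\<phi>\<in>Zsph N. \<forall>u. B \<phi> u = of_nat (delta \<phi>) * integral\<^sup>L \<omega>G (\<lambda>x. f (x, u) * cnj (\<phi> x))"
    proof (intro ballI allI)
      fix \<phi> u assume \<phi>: "\<phi> \<in> Zsph N"
      have "B \<phi> u = coef (\<lambda>x. f (x, u)) \<phi>"
      proof (rule ip_uniform_expansion[OF f_slice[OF f_cont] \<phi>])
        fix e :: real assume "e > 0"
        obtain F0 where "finite F0" "F0 \<subseteq> Zsph N" "\<forall>F. finite F \<and> F0 \<subseteq> F \<and> F \<subseteq> Zsph N \<longrightarrow>
            (\<forall>x u. norm (f (x, u) - (\<Sum>\<phi>\<in>F. B \<phi> u * \<phi> x)) < e)"
          using uniform[OF \<open>e > 0\<close>] by (elim exE conjE)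
        then show "\<exists>F0. finite F0 \<and> F0 \<subseteq> Zsph N \<and> (\<forall>F. finite F \<and> F0 \<subseteq> F \<and> F \<subseteq> Zsph N \<longrightarrow>
            (\<forall>x. norm (f (x, u) - (\<Sum>\<phi>\<in>F. B \<phi> u * \<phi> x)) < e))"
          by (intro exI[of _ F0]) simp
      qed
      then show "B \<phi> u = of_nat (delta \<phi>) * integral\<^sup>L \<omega>G (\<lambda>x. f (x, u) * cnj (\<phi> x))"
        by (simp add: coef_def)
    qed
  qed
qed

end
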